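(* Let $m,n,r,d$ be integers with $m,n\ge2$, $d\ge1$, $0<r<\min\{m,n\}$; for $0\le a\le rd$ let $d_R=\lfloor a/r\rfloor$, $t_R=a\bmod r$. Let $\mathcal{B}_a$ be the set of products $L(\lambda)R(\lambda)$, $L\in\mathbb{C}[\lambda]^{m\times r}$, $R\in\mathbb{C}[\lambda]^{r\times n}$, with $\deg(R_{i*})=d_R+1$ for $i\le t_R$, $\deg(R_{i*})=d_R$ for $t_R<i\le r$, and $\deg(L_{*i})=d-\deg(R_{i*})$ for all $i$; and let $\mathcal{C}_a$ be the set of products $L(\lambda)R(\lambda)$, $L\in\mathbb{C}[\lambda]^{m\times r}$, $R\in\mathbb{C}[\lambda]^{r\times n}$, with $\deg(R_{i*})\le d_R+1$ and $\deg(L_{*i})\le d-d_R-1$ for $i\le t_R$, and $\deg(R_{i*})\le d_R$ and $\deg(L_{*i})\le d-d_R$ for $t_R<i\le r$. Then: (i) $\mathcal{B}_a\subseteq\mathcal{C}_a$ for $a=0,\dots,rd$; (ii) $\overline{\mathcal{B}_a}=\overline{\mathcal{C}_a}$ for $a=0,\dots,rd$; (iii) $\mathbb{C}[\lambda]^{m\times n}_{d,r}=\bigcup_{0\le a\le rd}\overline{\mathcal{C}_a}$; (iv) for every $P(\lambda)\in\mathbb{C}[\lambda]^{m\times n}_{d,r}$ there exists an integer $a$ with $P(\lambda)\in\overline{\mathcal{C}_a}$.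
   Context: $\mathbb{C}[\lambda]^{m\times n}_{d,r}$: complex $m\times n$ polynomial matrices of degree at most $d$ and normal rank (rank over $\mathbb{C}(\lambda)$) at most $r$. Degree of a polynomial vector: maximum degree of entries, $\deg0=-\infty$. $L_{*i}$: $i$th column; $R_{i*}$: $i$th row. Closures are in $\mathbb{C}[\lambda]^{m\times n}_d$ with metric $\mathrm{dist}(P,Q)=(\sum_{i=0}^d\|P_i-Q_i\|_F^2)^{1/2}$, $P_i,Q_i$ the coefficients of $\lambda^i$. *)

theory Defs
  imports Complex_Main "HOL-Computational_Algebra.Polynomial"
    "HOL-Computational_Algebra.Fraction_Field" "HOL-Library.Extended_Real"
begin

text \<open>Polynomial matrices are represented as functions nat => nat => complex poly;
  an m x n polynomial matrix is one that vanishes outside the index range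
  {..<m} x {..<n} (0-based indices).\<close>

type_synonym pmatrix = "nat \<Rightarrow> nat \<Rightarrow> complex poly"

definition pmat :: "nat \<Rightarrow> nat \<Rightarrow> pmatrix set" where
  "pmat m n = {P. \<forall>i j. (m \<le> i \<or> n \<le> j) \<longrightarrow> P i j = 0}"

definition pmat_deg :: "nat \<Rightarrow> nat \<Rightarrow> nat \<Rightarrow> pmatrix set" where
  "pmat_deg m n d = {P \<in> pmat m n. \<forall>i<m. \<forall>j<n. degree (P i j) \<le> d}"

definition pmult :: "nat \<Rightarrow> nat \<Rightarrow> nat \<Rightarrow> pmatrix \<Rightarrow> pmatrix \<Rightarrow> pmatrix" where
  "pmult m r n L R = (\<lambda>i j. if i < m \<and> j < n then (\<Sum>k<r. L i k * R k j) else 0)"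

definition vdeg :: "nat \<Rightarrow> (nat \<Rightarrow> complex poly) \<Rightarrow> ereal" where
  "vdeg k v = (if \<forall>j<k. v j = 0 then -\<infinity>
               else ereal (real (Max ((\<lambda>j. degree (v j)) ` {..<k}))))"

definition row_deg :: "nat \<Rightarrow> pmatrix \<Rightarrow> nat \<Rightarrow> ereal" where
  "row_deg n R i = vdeg n (\<lambda>j. R i j)"

definition col_deg :: "nat \<Rightarrow> pmatrix \<Rightarrow> nat \<Rightarrow> ereal" where
  "col_deg m L i = vdeg m (\<lambda>j. L j i)"

definition lin_indep_cols :: "nat \<Rightarrow> (nat \<Rightarrow> nat \<Rightarrow> 'a::field) \<Rightarrow> nat set \<Rightarrow> bool" where
  "lin_indep_cols m A J \<longleftrightarrow>
     (\<forall>\<alpha>. (\<forall>i<m. (\<Sum>j\<in>J. \<alpha> j * A i j) = 0) \<longrightarrow> (\<forall>j\<in>J. \<alpha> j = 0))"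

definition mat_rank :: "nat \<Rightarrow> nat \<Rightarrow> (nat \<Rightarrow> nat \<Rightarrow> 'a::field) \<Rightarrow> nat" where
  "mat_rank m n A = Max {card J | J. J \<subseteq> {..<n} \<and> lin_indep_cols m A J}"

definition normal_rank :: "nat \<Rightarrow> nat \<Rightarrow> pmatrix \<Rightarrow> nat" where
  "normal_rank m n P = mat_rank m n (\<lambda>i j. Fract (P i j) 1)"

definition pmat_dr :: "nat \<Rightarrow> nat \<Rightarrow> nat \<Rightarrow> nat \<Rightarrow> pmatrix set" where
  "pmat_dr m n d r = {P \<in> pmat_deg m n d. normal_rank m n P \<le> r}"

definition pdist :: "nat \<Rightarrow> nat \<Rightarrow> nat \<Rightarrow> pmatrix \<Rightarrow> pmatrix \<Rightarrow> real" where
  "pdist m n d P Q = sqrt (\<Sum>k\<le>d. \<Sum>i<m. \<Sum>j<n. (cmod (coeff (P i j) k - coeff (Q i j) k))\<^sup>2)"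

definition pclosure :: "nat \<Rightarrow> nat \<Rightarrow> nat \<Rightarrow> pmatrix set \<Rightarrow> pmatrix set" where
  "pclosure m n d S = {P \<in> pmat_deg m n d. \<forall>e>0. \<exists>Q\<in>S. pdist m n d P Q < e}"

definition B_set :: "nat \<Rightarrow> nat \<Rightarrow> nat \<Rightarrow> nat \<Rightarrow> nat \<Rightarrow> pmatrix set" where
  "B_set m n r d a = (let dR = a div r; tR = a mod r in
     {pmult m r n L R | L R. L \<in> pmat m r \<and> R \<in> pmat r n \<and>
        (\<forall>i<r. row_deg n R i = ereal (real (if i < tR then dR + 1 else dR))) \<and>
        (\<forall>i<r. col_deg m L i = ereal (real d) - row_deg n R i)})"

definition C_set :: "nat \<Rightarrow> nat \<Rightarrow> nat \<Rightarrow> nat \<Rightarrow> nat \<Rightarrow> pmatrix set" where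
  "C_set m n r d a = (let dR = a div r; tR = a mod r in
     {pmult m r n L R | L R. L \<in> pmat m r \<and> R \<in> pmat r n \<and>
        (\<forall>i<r. i < tR \<longrightarrow> row_deg n R i \<le> ereal (real dR + 1) \<and>
                            col_deg m L i \<le> ereal (real d - real dR - 1)) \<and>
        (\<forall>i<r. tR \<le> i \<longrightarrow> row_deg n R i \<le> ereal (real dR) \<and>
                            col_deg m L i \<le> ereal (real d - real dR))})"

end

theory Submission
  imports Defs "HOL-Analysis.Analysis"
    "HOL-Computational_Algebra.Polynomial_Factorial"
    "HOL-Computational_Algebra.Fundamental_Theorem_Algebra"
begin

text \<open>
  Write \<open>S\<^sub>D\<close> for the products whose \<open>k\<close>-th summand (column \<open>k\<close> of \<open>L\<close> times row \<open>k\<close>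
  of \<open>R\<close>) has row degree at most \<open>D k\<close> and column degree at most \<open>d - D k\<close>;
  \<open>C\<^sub>a\<close> is \<open>S\<^sub>D\<close> for the most balanced \<open>D\<close> of sum \<open>a\<close>.

  A matrix \<open>P\<close> of degree at most \<open>d\<close> and rank at most \<open>r\<close> lies in some \<open>S\<^sub>D\<close>: start from a
  factorization of a multiple \<open>q P\<close> through a maximal set of independent columns. As long as the rows
  of \<open>R\<close> are dependent at a root of \<open>q\<close>, or at infinity, one of them can be replaced by one of
  smaller degree; when they are independent at a root, \<open>L\<close> is divisible by the linear factor. In the
  end \<open>q\<close> is constant and the leading coefficients of the rows are independent, so that no
  cancellation of top degrees can occur in \<open>L R\<close>.

  If \<open>D p > D q\<close>, then \<open>S\<^sub>D\<close> is in the closure of the set with \<open>D p\<close> lowered and \<open>D q\<close> raised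
  by one. For a product \<open>l\<^sub>1 r\<^sub>1 + l\<^sub>2 r\<^sub>2\<close> write \<open>r\<^sub>1 = x u - v\<close> and \<open>l\<^sub>2 = x f + g\<close> with \<open>v\<close>, \<open>g\<close>
  constant; then
  \<open>(x l\<^sub>1 / e + g) (r\<^sub>2 + e u) + (f - l\<^sub>1 / e) (x r\<^sub>2 + e v) = l\<^sub>1 r\<^sub>1 + l\<^sub>2 r\<^sub>2 + e (f v + g u)\<close>.
  Iterating such moves leads to the balanced \<open>D\<close>.

  The rank bound is closed: for \<open>Q\<close> in \<open>S\<^sub>D\<close>, counting coefficients gives any \<open>r + 1\<close> columns a
  polynomial relation of uniformly bounded degree, and normalized relations have a limit.
\<close>

subsection \<open>Closures of sets of polynomial matrices\<close>

text \<open>\<open>L\<close> and \<open>R\<close> are left unconstrained outside their index ranges,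
  so that witnesses need no padding by zeros. The truncated \<open>d - D k\<close> is the intended
  bound once \<open>D k \<le> d\<close>, a condition carried along as a hypothesis or supplied by
  \<open>bal_deg_le\<close>.\<close>

definition prod_set :: "nat \<Rightarrow> nat \<Rightarrow> nat \<Rightarrow> nat \<Rightarrow> (nat \<Rightarrow> nat) \<Rightarrow> pmatrix set" where
  "prod_set m n r d D = {pmult m r n L R | L R.
     (\<forall>k<r. \<forall>j<n. degree (R k j) \<le> D k) \<and> (\<forall>k<r. \<forall>i<m. degree (L i k) \<le> d - D k)}"

lemma pmult_in_pmat: "pmult m r n L R \<in> pmat m n"
  by (auto simp: pmult_def pmat_def)

lemma prod_set_subset_pmat_deg:
  assumes "\<And>k. k < r \<Longrightarrow> D k \<le> d"
  shows "prod_set m n r d D \<subseteq> pmat_deg m n d"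
proof
  fix P assume "P \<in> prod_set m n r d D"
  then obtain L R where P: "P = pmult m r n L R"
    and R: "\<And>k j. k < r \<Longrightarrow> j < n \<Longrightarrow> degree (R k j) \<le> D k"
    and L: "\<And>k i. k < r \<Longrightarrow> i < m \<Longrightarrow> degree (L i k) \<le> d - D k"
    by (auto simp: prod_set_def)
  have "degree (P i j) \<le> d" if "i < m" "j < n" for i j
  proof -
    have "degree (L i k * R k j) \<le> d" if "k < r" for k
      using degree_mult_le[of "L i k" "R k j"] L[OF that \<open>i < m\<close>] R[OF that \<open>j < n\<close>] assms[OF that]
      by linarith
    then show ?thesis using that by (auto simp: P pmult_def intro!: degree_sum_le)
  qed
  then show "P \<in> pmat_deg m n d"
    by (simp add: pmat_deg_def P pmult_in_pmat)
qed

text \<open>In this form the triangle inequality and the bound of one coordinate by the norm become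
  facts about \<open>L2_set\<close>.\<close>

lemma pdist_L2_set:
  "pdist m n d P Q = L2_set (\<lambda>(k,i,j). cmod (coeff (P i j) k - coeff (Q i j) k)) ({..d} \<times> {..<m} \<times> {..<n})"
  by (simp add: pdist_def L2_set_def sum.cartesian_product case_prod_unfold)

lemma pdist_triangle: "pdist m n d P R \<le> pdist m n d P Q + pdist m n d Q R"
proof -
  have "pdist m n d P R \<le> L2_set (\<lambda>x. (\<lambda>(k,i,j). cmod (coeff (P i j) k - coeff (Q i j) k)) x
      + (\<lambda>(k,i,j). cmod (coeff (Q i j) k - coeff (R i j) k)) x) ({..d} \<times> {..<m} \<times> {..<n})"
    unfolding pdist_L2_set
    by (rule L2_set_mono) (auto simp: norm_diff_triangle_ineq intro: norm_diff_triangle_le)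
  also have "\<dots> \<le> pdist m n d P Q + pdist m n d Q R"
    unfolding pdist_L2_set by (rule L2_set_triangle_ineq)
  finally show ?thesis .
qed

lemma coeff_diff_le_pdist:
  assumes "i < m" "j < n" "k \<le> d"
  shows "cmod (coeff (P i j) k - coeff (Q i j) k) \<le> pdist m n d P Q"
  unfolding pdist_L2_set
  using member_le_L2_set[of "{..d} \<times> {..<m} \<times> {..<n}" "(k,i,j)"
      "\<lambda>(k,i,j). cmod (coeff (P i j) k - coeff (Q i j) k)"] assms by simp

lemma pclosure_mono: "S \<subseteq> T \<Longrightarrow> pclosure m n d S \<subseteq> pclosure m n d T"
  unfolding pclosure_def by blast

lemma pclosure_minimal:
  assumes "S \<subseteq> pclosure m n d T"
  shows "pclosure m n d S \<subseteq> pclosure m n d T"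
proof
  fix P assume P: "P \<in> pclosure m n d S"
  have "\<exists>Q\<in>T. pdist m n d P Q < e" if "e > 0" for e
  proof -
    have "\<forall>e>0. \<exists>Q\<in>S. pdist m n d P Q < e" using P by (simp add: pclosure_def)
    with that have "\<exists>Q\<in>S. pdist m n d P Q < e/2" using half_gt_zero by blast
    then obtain Q where Q: "Q \<in> S" "pdist m n d P Q < e/2" by blast
    with assms have "Q \<in> pclosure m n d T" by blast
    then have "\<forall>e>0. \<exists>Q'\<in>T. pdist m n d Q Q' < e" by (simp add: pclosure_def)
    with that have "\<exists>Q'\<in>T. pdist m n d Q Q' < e/2" using half_gt_zero by blast
    then obtain Q' where "Q' \<in> T" "pdist m n d Q Q' < e/2" by blast
    with Q pdist_triangle[of m n d P Q' Q] show ?thesis by force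
  qed
  with P show "P \<in> pclosure m n d T" by (auto simp: pclosure_def)
qed

lemma subset_pclosure: "S \<subseteq> pmat_deg m n d \<Longrightarrow> S \<subseteq> pclosure m n d S"
  by (force simp: pclosure_def pdist_def)

text \<open>Each degeneration below is a family whose product depends polynomially on
  \<open>e\<close> and equals \<open>P\<close> at 0, so continuity of \<open>pdist\<close> in
  \<open>e\<close> suffices. Degree two covers linear perturbations of both factors. Only positive
  \<open>e\<close> occur, because the factors themselves may contain \<open>1 / e\<close>.\<close>

lemma in_pclosure_quadratic:
  assumes P: "P \<in> pmat_deg m n d"
    and Q: "\<And>e::real. e > 0 \<Longrightarrow> Q e \<in> S"
    and eq: "\<And>e i j. e > 0 \<Longrightarrow> i < m \<Longrightarrow> j < n \<Longrightarrow>
       Q e i j = P i j + smult (of_real e) (A i j) + smult (of_real (e\<^sup>2)) (B i j)"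
  shows "P \<in> pclosure m n d S"
proof -
  have "((\<lambda>e. pdist m n d P (\<lambda>i j. P i j + smult (of_real e) (A i j) + smult (of_real (e\<^sup>2)) (B i j)))
     \<longlongrightarrow> sqrt (\<Sum>k\<le>d. \<Sum>i<m. \<Sum>j<n. (cmod (coeff (P i j) k - (coeff (P i j) k
            + of_real 0 * coeff (A i j) k + of_real (0\<^sup>2) * coeff (B i j) k)))\<^sup>2)) (at_right 0)"
    unfolding pdist_def coeff_add coeff_smult by (intro tendsto_intros)
  then have lim: "((\<lambda>e. pdist m n d P (\<lambda>i j. P i j + smult (of_real e) (A i j) + smult (of_real (e\<^sup>2)) (B i j)))
     \<longlongrightarrow> 0) (at_right 0)" by simp
  have "\<exists>Q\<in>S. pdist m n d P Q < \<delta>" if "\<delta> > 0" for \<delta>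
  proof -
    have "eventually (\<lambda>e. pdist m n d P (\<lambda>i j. P i j + smult (of_real e) (A i j) + smult (of_real (e\<^sup>2)) (B i j)) < \<delta> \<and> e > 0)
        (at_right (0::real))"
      using order_tendstoD(2)[OF lim that] eventually_at_right_less[of "0::real"]
      by (rule eventually_conj)
    then obtain e :: real where e: "e > 0"
      "pdist m n d P (\<lambda>i j. P i j + smult (of_real e) (A i j) + smult (of_real (e\<^sup>2)) (B i j)) < \<delta>"
      using eventually_happens[of _ "at_right (0::real)"] by (auto simp: trivial_limit_at_right_real)
    moreover have "pdist m n d P (Q e) = pdist m n d P (\<lambda>i j. P i j + smult (of_real e) (A i j) + smult (of_real (e\<^sup>2)) (B i j))"
      unfolding pdist_def by (intro arg_cong[of _ _ sqrt] sum.cong refl) (simp add: eq[OF e(1)])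
    ultimately show ?thesis using Q[OF e(1)] e(2) by (intro bexI[of _ "Q e"]) simp_all
  qed
  with P show ?thesis by (simp add: pclosure_def)
qed

subsection \<open>Degenerations between degree distributions\<close>

lemma pCons_poly_shift: "pCons (coeff p 0) (poly_shift 1 p) = p"
  by (rule poly_eqI) (simp add: coeff_pCons coeff_poly_shift split: nat.split)

lemma degree_poly_shift: "degree (poly_shift 1 p) \<le> degree p - 1"
  by (rule degree_le) (auto simp: coeff_poly_shift coeff_eq_0)

lemma degree_pCons_le_Suc: "degree p \<le> k \<Longrightarrow> degree (pCons c p) \<le> Suc k"
  by (rule order.trans[OF degree_pCons_le]) simp

lemma sum_remove_two:
  assumes "finite A" "p \<in> A" "q \<in> A" "p \<noteq> q"
  shows "sum h A = h p + h q + sum h (A - {p, q})"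
proof -
  have "sum h A = sum h {p, q} + sum h (A - {p, q})"
    using assms by (subst sum.subset_diff[of "{p, q}"]) (auto simp: add.commute)
  with assms show ?thesis by simp
qed

text \<open>The inequality \<open>D q < D p\<close> is what allows the exchange: row
  \<open>q\<close> of \<open>R\<close> fits under the new bound \<open>D p - 1\<close>, and column
  \<open>p\<close> of \<open>L\<close> fits under \<open>d - D q - 1\<close>, so each can be mixed
  into the other slot.\<close>

lemma prod_set_shift:
  assumes D: "\<And>k. k < r \<Longrightarrow> D k \<le> d" and ij: "p < r" "q < r" "D q < D p"
  shows "prod_set m n r d D \<subseteq> pclosure m n d (prod_set m n r d (D(p := D p - 1, q := D q + 1)))"
proof
  fix P assume PD: "P \<in> prod_set m n r d D"
  then obtain L R where P: "P = pmult m r n L R"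
    and R: "\<And>k j. k < r \<Longrightarrow> j < n \<Longrightarrow> degree (R k j) \<le> D k"
    and L: "\<And>k i. k < r \<Longrightarrow> i < m \<Longrightarrow> degree (L i k) \<le> d - D k"
    by (auto simp: prod_set_def)
  have neq: "p \<noteq> q" using ij by auto
  let ?D = "D(p := D p - 1, q := D q + 1)"
  \<comment> \<open>Constant terms are split off so that \<open>R p = x u - v\<close> and
    \<open>L q = x f + g\<close>. The degrees of \<open>u\<close> and \<open>f\<close> drop by one,
    and constants fit under any bound.\<close>
  define u where "u c = poly_shift 1 (R p c)" for c
  define v where "v c = [:- coeff (R p c) 0:]" for c
  define f where "f b = poly_shift 1 (L b q)" for b
  define g where "g b = [:coeff (L b q) 0:]" for b
  \<comment> \<open>The singular terms \<open>x L p R q / e\<close> of the slots \<open>p\<close>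
    and \<open>q\<close> cancel, so the product has a limit although \<open>L' e\<close> contains
    \<open>1 / e\<close>.\<close>
  define R' where "R' e k c = (if k = p then R q c + smult (complex_of_real e) (u c)
     else if k = q then pCons 0 (R q c) + smult (of_real e) (v c) else R k c)" for e k c
  define L' where "L' e b k = (if k = p then smult (inverse (complex_of_real e)) (pCons 0 (L b p)) + g b
     else if k = q then f b - smult (inverse (of_real e)) (L b p) else L b k)" for e b k
  have Rp: "R p c = pCons 0 (u c) - v c" for c
    by (subst pCons_poly_shift[symmetric]) (simp add: u_def v_def)
  have Lq: "L b q = pCons 0 (f b) + g b" for b
    by (subst pCons_poly_shift[symmetric]) (simp add: f_def g_def)
  show "P \<in> pclosure m n d (prod_set m n r d ?D)"
  proof (rule in_pclosure_quadratic)
    show "P \<in> pmat_deg m n d" using prod_set_subset_pmat_deg[of r D d m n] D PD by blast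
  next
    fix e :: real assume e: "e > 0"
    have "degree (R' e k c) \<le> ?D k" if "k < r" "c < n" for k c
    proof -
      have "degree (u c) \<le> D p - 1"
        using degree_poly_shift[of "R p c"] R[of p c] ij that unfolding u_def by linarith
      moreover have "degree (R q c) \<le> D q" using R ij that by blast
      ultimately show ?thesis using that neq ij R[of k c]
        by (auto simp: R'_def v_def intro!: degree_add_le degree_pCons_le_Suc order.trans[OF degree_smult_le])
    qed
    moreover have "degree (L' e b k) \<le> d - ?D k" if "k < r" "b < m" for k b
    proof -
      have "degree (f b) \<le> d - D q - 1"
        using degree_poly_shift[of "L b q"] L[of q b] ij that unfolding f_def by linarith
      moreover have p: "degree (L b p) \<le> d - D p" using L ij that by blast
      moreover have "degree (pCons 0 (L b p)) \<le> d - (D p - 1)"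
        using degree_pCons_le_Suc[OF p, of 0] ij D[of p] by simp
      ultimately show ?thesis using that neq ij L[of k b] D[of p]
        by (auto simp: L'_def g_def intro!: degree_add_le degree_diff_le order.trans[OF degree_smult_le])
    qed
    ultimately show "pmult m r n (L' e) (R' e) \<in> prod_set m n r d ?D"
      unfolding prod_set_def by blast
  next
    fix e :: real and b c assume e: "e > 0" and bc: "b < m" "c < n"
    have split: "(\<Sum>k<r. h k) = h p + h q + (\<Sum>k\<in>{..<r}-{p,q}. h k)" for h :: "nat \<Rightarrow> complex poly"
      using sum_remove_two[of "{..<r}" p q h] ij neq by simp
    \<comment> \<open>With \<open>1 / e\<close> and \<open>e\<close> kept as constant polynomials,
      the expansion is a pure ring identity, and only their product has to be evaluated.\<close>
    have e1: "[:inverse (of_real e):] * [:of_real e:] = (1 :: complex poly)"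
      using e by (simp add: one_pCons)
    have "L' e b p * R' e p c + L' e b q * R' e q c =
       ([:inverse (of_real e):] * ([:0,1:] * L b p) + g b) * (R q c + [:of_real e:] * u c)
       + (f b - [:inverse (of_real e):] * L b p) * ([:0,1:] * R q c + [:of_real e:] * v c)"
      using neq by (simp add: L'_def R'_def)
    also have "\<dots> = ([:inverse (of_real e):] * [:of_real e:]) * L b p * ([:0,1:] * u c - v c)
        + ([:0,1:] * f b + g b) * R q c + [:of_real e:] * (f b * v c + g b * u c)"
      by (simp only: algebra_simps)
    also have "\<dots> = L b p * R p c + L b q * R q c + [:of_real e:] * (f b * v c + g b * u c)"
      unfolding e1 Rp Lq by simp
    finally have main: "L' e b p * R' e p c + L' e b q * R' e q c
      = L b p * R p c + L b q * R q c + [:of_real e:] * (f b * v c + g b * u c)" .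
    have rest: "(\<Sum>k\<in>{..<r}-{p,q}. L' e b k * R' e k c) = (\<Sum>k\<in>{..<r}-{p,q}. L b k * R k c)"
      by (rule sum.cong) (auto simp: L'_def R'_def)
    show "pmult m r n (L' e) (R' e) b c = P b c + smult (of_real e) (f b * v c + g b * u c)
       + smult (of_real (e\<^sup>2)) 0"
      using bc main by (simp add: P pmult_def split rest)
  qed
qed

text \<open>Induction on the total excess of \<open>D\<close> over \<open>T\<close>, with truncated
  differences. Since the sums agree, an index above its target forces another one below, and moving
  one unit between them lowers the excess.\<close>

lemma prod_set_balance:
  assumes "\<And>k. k < r \<Longrightarrow> D k \<le> d" and "\<And>k. k < r \<Longrightarrow> T k \<le> d"
    and "(\<Sum>k<r. D k) = (\<Sum>k<r. T k)"
    and T: "\<And>k l. k < r \<Longrightarrow> l < r \<Longrightarrow> T k \<le> T l + 1"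
  shows "prod_set m n r d D \<subseteq> pclosure m n d (prod_set m n r d T)"
  using assms(1,3)
proof (induction "\<Sum>k<r. D k - T k" arbitrary: D rule: less_induct)
  case less
  show ?case
  proof (cases "\<exists>p<r. T p < D p")
    case False
    then have le: "\<And>k. k < r \<Longrightarrow> D k \<le> T k" by auto
    have "D k = T k" if "k < r" for k
    proof (rule ccontr)
      assume "D k \<noteq> T k"
      with le that have "(\<Sum>k<r. D k) < (\<Sum>k<r. T k)"
        by (intro sum_strict_mono_ex1) (auto intro!: bexI[of _ k] simp: le_neq_implies_less)
      with less.prems(2) show False by simp
    qed
    then have "prod_set m n r d D = prod_set m n r d T" by (simp add: prod_set_def)
    then show ?thesis using subset_pclosure prod_set_subset_pmat_deg assms(2) by metis
  next
    case True
    then obtain p where p: "p < r" "T p < D p" by blast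
    have "\<exists>q<r. D q < T q"
    proof (rule ccontr)
      assume "\<not> ?thesis"
      then have "\<forall>k<r. T k \<le> D k" by (meson not_less)
      with p have "(\<Sum>k<r. T k) < (\<Sum>k<r. D k)"
        by (intro sum_strict_mono_ex1) (auto intro!: bexI[of _ p])
      with less.prems(2) show False by simp
    qed
    then obtain q where q: "q < r" "D q < T q" by blast
    let ?D = "D(p := D p - 1, q := D q + 1)"
    have neq: "p \<noteq> q" using p q by auto
    have split: "(\<Sum>k<r. h k) = h p + h q + (\<Sum>k\<in>{..<r}-{p,q}. h k)" for h :: "nat \<Rightarrow> nat"
      using sum_remove_two[of "{..<r}" p q h] p q neq by simp
    have rest: "(\<Sum>k\<in>{..<r}-{p,q}. ?D k) = (\<Sum>k\<in>{..<r}-{p,q}. D k)"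
      "(\<Sum>k\<in>{..<r}-{p,q}. ?D k - T k) = (\<Sum>k\<in>{..<r}-{p,q}. D k - T k)"
      by (rule sum.cong; auto)+
    \<comment> \<open>This is where balance of \<open>T\<close> enters:
      \<open>D q < T q \<le> T p + 1 \<le> D p\<close>.\<close>
    have "D q < D p" using p q T[of q p] by linarith
    then have "prod_set m n r d D \<subseteq> pclosure m n d (prod_set m n r d ?D)"
      using prod_set_shift less.prems(1) p(1) q(1) by blast
    moreover have "prod_set m n r d ?D \<subseteq> pclosure m n d (prod_set m n r d T)"
    proof (rule less.hyps)
      show "(\<Sum>k<r. ?D k - T k) < (\<Sum>k<r. D k - T k)"
        unfolding split rest using p q neq by simp
      show "?D k \<le> d" if "k < r" for k
      proof -
        have "T q \<le> d" "D p \<le> d" using assms(2) less.prems(1) p q by auto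
        with less.prems(1)[OF that] q(2) show ?thesis by auto
      qed
      show "(\<Sum>k<r. ?D k) = (\<Sum>k<r. T k)"
        using less.prems(2) p unfolding split[of ?D] split[of D] rest using neq by simp
    qed
    ultimately show ?thesis using pclosure_minimal by blast
  qed
qed

lemma smult_sum_right: "smult c (sum f A) = (\<Sum>x\<in>A. smult c (f x))"
  by (induction A rule: infinite_finite_induct) (auto simp: smult_add_right)

subsection \<open>Comparison with the sets of the theorem\<close>

text \<open>For upper bounds the two conventions for zero agree: the value
  \<open>-\<infinity>\<close> of a zero vector and the degree 0 of a zero polynomial both lie below
  every natural number.\<close>

lemma vdeg_le_iff: "vdeg k v \<le> ereal (real D) \<longleftrightarrow> (\<forall>j<k. degree (v j) \<le> D)"
proof (cases "\<forall>j<k. v j = 0")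
  case False
  then have "{..<k} \<noteq> {}" by auto
  then have "Max ((\<lambda>j. degree (v j)) ` {..<k}) \<le> D \<longleftrightarrow> (\<forall>j<k. degree (v j) \<le> D)"
    by (subst Max_le_iff) auto
  with False show ?thesis by (auto simp: vdeg_def)
qed (auto simp: vdeg_def)

text \<open>A nonzero coefficient at \<open>D\<close>, rather than an entry of degree
  \<open>D\<close>, also excludes the zero vector when \<open>D = 0\<close>.\<close>

lemma vdeg_eqI:
  assumes "\<And>j. j < k \<Longrightarrow> degree (v j) \<le> D" "j0 < k" "coeff (v j0) D \<noteq> 0"
  shows "vdeg k v = ereal (real D)"
proof -
  have "degree (v j0) = D" using assms le_degree by (meson antisym)
  then have "Max ((\<lambda>j. degree (v j)) ` {..<k}) = D"
    using assms by (intro Max_eqI) auto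
  with assms show ?thesis by (auto simp: vdeg_def)
qed

lemma pmult_cong:
  assumes "\<And>i k. i < m \<Longrightarrow> k < r \<Longrightarrow> L i k = L' i k"
    and "\<And>k j. k < r \<Longrightarrow> j < n \<Longrightarrow> R k j = R' k j"
  shows "pmult m r n L R = pmult m r n L' R'"
  using assms by (auto simp: pmult_def fun_eq_iff intro!: sum.cong)

definition bal_deg :: "nat \<Rightarrow> nat \<Rightarrow> nat \<Rightarrow> nat" where
  "bal_deg r a k = (if k < a mod r then a div r + 1 else a div r)"

text \<open>The value \<open>d + 1\<close> could only arise from \<open>a div r = d\<close>; then
  \<open>a \<le> r * d\<close> leaves remainder 0, so no index receives the extra unit.\<close>

lemma bal_deg_le:
  assumes "a \<le> r * d" "0 < r"
  shows "bal_deg r a k \<le> d"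
proof (cases "a div r = d")
  case True
  have "r * (a div r) + a mod r = a" by simp
  with True assms(1) have "a mod r = 0" by simp
  with True show ?thesis by (simp add: bal_deg_def)
next
  case False
  have "a div r \<le> d" using div_le_mono[OF assms(1), of r] assms(2) by simp
  with False show ?thesis by (simp add: bal_deg_def)
qed

lemma sum_bal_deg:
  assumes "0 < r"
  shows "(\<Sum>k<r. bal_deg r a k) = a"
proof -
  have "(\<Sum>k<r. bal_deg r a k) = (\<Sum>k<r. a div r + (if k < a mod r then 1 else 0))"
    by (intro sum.cong) (auto simp: bal_deg_def)
  also have "\<dots> = r * (a div r) + card {k\<in>{..<r}. k < a mod r}"
    by (simp add: sum.distrib sum.If_cases Int_def)
  also have "{k\<in>{..<r}. k < a mod r} = {..<a mod r}"
    using mod_less_divisor[OF assms, of a] by auto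
  finally show ?thesis by simp
qed

text \<open>As \<open>bal_deg\<close> never exceeds \<open>d\<close>, the real differences bounding
  the columns of \<open>L\<close> agree with truncated subtraction of naturals.\<close>

lemma C_set_eq_prod_set:
  assumes "a \<le> r * d" "0 < r"
  shows "C_set m n r d a = prod_set m n r d (bal_deg r a)"
proof -
  have T: "bal_deg r a k \<le> d" for k using bal_deg_le[OF assms] .
  let ?ok = "\<lambda>L R. (\<forall>k<r. \<forall>j<n. degree (R k j) \<le> bal_deg r a k) \<and>
          (\<forall>k<r. \<forall>i<m. degree (L i k) \<le> d - bal_deg r a k)"
  have deg: "(\<forall>i<r. i < a mod r \<longrightarrow> row_deg n R i \<le> ereal (real (a div r) + 1) \<and>
                            col_deg m L i \<le> ereal (real d - real (a div r) - 1)) \<and>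
        (\<forall>i<r. a mod r \<le> i \<longrightarrow> row_deg n R i \<le> ereal (real (a div r)) \<and>
                            col_deg m L i \<le> ereal (real d - real (a div r))) \<longleftrightarrow> ?ok L R" for L R
  proof -
    have "?ok L R \<longleftrightarrow> (\<forall>k<r. row_deg n R k \<le> ereal (real (bal_deg r a k)) \<and>
            col_deg m L k \<le> ereal (real (d - bal_deg r a k)))"
      unfolding row_deg_def col_deg_def vdeg_le_iff by blast
    also have "\<dots> \<longleftrightarrow> (\<forall>k<r. row_deg n R k \<le> ereal (real (bal_deg r a k)) \<and>
            col_deg m L k \<le> ereal (real d - real (bal_deg r a k)))"
      using T by (simp add: of_nat_diff)
    also have "\<dots> \<longleftrightarrow> (\<forall>i<r. i < a mod r \<longrightarrow> row_deg n R i \<le> ereal (real (a div r) + 1) \<and>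
                            col_deg m L i \<le> ereal (real d - real (a div r) - 1)) \<and>
        (\<forall>i<r. a mod r \<le> i \<longrightarrow> row_deg n R i \<le> ereal (real (a div r)) \<and>
                            col_deg m L i \<le> ereal (real d - real (a div r)))"
      by (auto simp: bal_deg_def not_less diff_diff_eq add.commute)
    finally show ?thesis by blast
  qed
  have "C_set m n r d a = {pmult m r n L R | L R. L \<in> pmat m r \<and> R \<in> pmat r n \<and> ?ok L R}"
    unfolding C_set_def Let_def deg ..
  also have "\<dots> = prod_set m n r d (bal_deg r a)"
  proof
    show "prod_set m n r d (bal_deg r a) \<subseteq> {pmult m r n L R | L R. L \<in> pmat m r \<and> R \<in> pmat r n \<and> ?ok L R}"
    proof
      fix P assume "P \<in> prod_set m n r d (bal_deg r a)"
      then obtain L R where P: "P = pmult m r n L R" and ok: "?ok L R"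
        unfolding prod_set_def by blast
      \<comment> \<open>\<open>C_set\<close> requires factors that vanish outside their index
        ranges; truncating them does not change the product.\<close>
      define L' where "L' i k = (if i < m \<and> k < r then L i k else 0)" for i k
      define R' where "R' k j = (if k < r \<and> j < n then R k j else 0)" for k j
      have "P = pmult m r n L' R'" unfolding P by (rule pmult_cong) (auto simp: L'_def R'_def)
      moreover have "?ok L' R'" using ok by (simp add: L'_def R'_def)
      moreover have "L' \<in> pmat m r" "R' \<in> pmat r n" by (auto simp: pmat_def L'_def R'_def)
      ultimately show "P \<in> {pmult m r n L R | L R. L \<in> pmat m r \<and> R \<in> pmat r n \<and> ?ok L R}" by blast
    qed
  qed (auto simp: prod_set_def)
  finally show ?thesis .
qed

lemma B_set_subset_prod_set:
  assumes "a \<le> r * d" "0 < r"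
  shows "B_set m n r d a \<subseteq> prod_set m n r d (bal_deg r a)"
proof
  fix P assume "P \<in> B_set m n r d a"
  then obtain L R where P: "P = pmult m r n L R"
    and R: "\<And>k. k < r \<Longrightarrow> row_deg n R k = ereal (real (bal_deg r a k))"
    and L: "\<And>k. k < r \<Longrightarrow> col_deg m L k = ereal (real d) - row_deg n R k"
    unfolding B_set_def Let_def bal_deg_def by blast
  have "row_deg n R k \<le> ereal (real (bal_deg r a k)) \<and>
            col_deg m L k \<le> ereal (real (d - bal_deg r a k))" if "k < r" for k
    using R[OF that] L[OF that] bal_deg_le[OF assms, of k] by (simp add: of_nat_diff)
  then show "P \<in> prod_set m n r d (bal_deg r a)"
    unfolding prod_set_def P row_deg_def col_deg_def vdeg_le_iff by blast
qed

text \<open>Degree bounds become exact after adding a small multiple of the top monomial to one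
  entry of each row of \<open>R\<close> and column of \<open>L\<close> whose top coefficient there
  vanishes.\<close>

lemma prod_set_subset_pclosure_B_set:
  assumes "a \<le> r * d" "0 < r" "0 < m" "0 < n"
  shows "prod_set m n r d (bal_deg r a) \<subseteq> pclosure m n d (B_set m n r d a)"
proof
  fix P assume PD: "P \<in> prod_set m n r d (bal_deg r a)"
  let ?T = "bal_deg r a"
  have T: "?T k \<le> d" for k using bal_deg_le[OF assms(1,2)] .
  obtain L R where P: "P = pmult m r n L R"
    and R: "\<And>k j. k < r \<Longrightarrow> j < n \<Longrightarrow> degree (R k j) \<le> ?T k"
    and L: "\<And>k i. k < r \<Longrightarrow> i < m \<Longrightarrow> degree (L i k) \<le> d - ?T k"
    using PD by (auto simp: prod_set_def)
  \<comment> \<open>A nonvanishing top coefficient is left alone, since an added \<open>e\<close>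
    could cancel it; the degrees are thus exact for every \<open>e > 0\<close>.\<close>
  define F where "F i k = (if i = 0 \<and> coeff (L i k) (d - ?T k) = 0
      then monom (1::complex) (d - ?T k) else 0)" for i k
  define E where "E k j = (if j = 0 \<and> coeff (R k j) (?T k) = 0
      then monom (1::complex) (?T k) else 0)" for k j
  define L' where "L' e i k = (if i < m \<and> k < r then L i k + smult (complex_of_real e) (F i k) else 0)" for e i k
  define R' where "R' e k j = (if k < r \<and> j < n then R k j + smult (complex_of_real e) (E k j) else 0)" for e k j
  show "P \<in> pclosure m n d (B_set m n r d a)"
  proof (rule in_pclosure_quadratic)
    show "P \<in> pmat_deg m n d" using prod_set_subset_pmat_deg[of r ?T d m n] T PD by blast
  next
    fix e :: real assume e: "e > 0"
    have Rd: "row_deg n (R' e) k = ereal (real (?T k))" if "k < r" for k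
      unfolding row_deg_def
    proof (rule vdeg_eqI[of _ _ _ 0])
      show "degree (R' e k j) \<le> ?T k" if "j < n" for j
        using R[OF \<open>k < r\<close> that] by (auto simp: R'_def E_def degree_monom_eq intro!: degree_add_le order.trans[OF degree_smult_le])
      show "coeff (R' e k 0) (?T k) \<noteq> 0"
        using that assms e by (auto simp: R'_def E_def)
    qed fact
    have Ld: "col_deg m (L' e) k = ereal (real (d - ?T k))" if "k < r" for k
      unfolding col_deg_def
    proof (rule vdeg_eqI[of _ _ _ 0])
      show "degree (L' e i k) \<le> d - ?T k" if "i < m" for i
        using L[OF \<open>k < r\<close> that] by (auto simp: L'_def F_def degree_monom_eq intro!: degree_add_le order.trans[OF degree_smult_le])
      show "coeff (L' e 0 k) (d - ?T k) \<noteq> 0"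
        using that assms e by (auto simp: L'_def F_def)
    qed fact
    have "col_deg m (L' e) k = ereal (real d) - row_deg n (R' e) k" if "k < r" for k
      using Rd[OF that] Ld[OF that] T[of k] by (simp add: of_nat_diff)
    moreover have "L' e \<in> pmat m r" "R' e \<in> pmat r n" by (auto simp: pmat_def L'_def R'_def)
    ultimately show "pmult m r n (L' e) (R' e) \<in> B_set m n r d a"
      using Rd unfolding B_set_def Let_def bal_deg_def by blast
  next
    fix e :: real and i j assume ij: "i < m" "j < n"
    have "(L i k + smult c (F i k)) * (R k j + smult c (E k j)) = L i k * R k j
      + smult c (F i k * R k j + L i k * E k j) + smult (c\<^sup>2) (F i k * E k j)" for k and c :: complex
      by (simp add: power2_eq_square distrib_left distrib_right smult_add_right)
    with ij show "pmult m r n (L' e) (R' e) i j = P i j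
      + smult (of_real e) (\<Sum>k<r. F i k * R k j + L i k * E k j)
      + smult (of_real (e\<^sup>2)) (\<Sum>k<r. F i k * E k j)"
      by (simp add: P pmult_def L'_def R'_def smult_sum_right sum.distrib smult_add_right)
  qed
qed

subsection \<open>Closedness of the rank bound\<close>

text \<open>Gaussian elimination: each equation with a nonzero coefficient uses up one unknown, and
  at least one unknown remains.\<close>

lemma underdetermined_system:
  fixes A :: "'k \<Rightarrow> 'n \<Rightarrow> 'a::field"
  assumes "finite K" "finite N" "card K < card N"
  shows "\<exists>x. (\<exists>j\<in>N. x j \<noteq> 0) \<and> (\<forall>i\<in>K. (\<Sum>j\<in>N. x j * A i j) = 0)"
  using assms
proof (induction K arbitrary: N A rule: finite_induct)
  case empty
  then have "N \<noteq> {}" by auto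
  then show ?case by (intro exI[of _ "\<lambda>_. 1"]) auto
next
  case (insert k K)
  show ?case
  proof (cases "\<forall>j\<in>N. A k j = 0")
    case True
    with insert.IH[of N A] insert show ?thesis by auto
  next
    case False
    then obtain j0 where j0: "j0 \<in> N" "A k j0 \<noteq> 0" by blast
    \<comment> \<open>The remaining equations after eliminating the unknown \<open>j0\<close> with
      the pivot \<open>A k j0\<close>; its value is recovered in \<open>y\<close> from equation
      \<open>k\<close>.\<close>
    define B where "B i j = A i j - A i j0 * A k j / A k j0" for i j
    have "card K < card (N - {j0})" using insert j0 by simp
    then obtain x where x: "\<exists>j\<in>N-{j0}. x j \<noteq> 0" "\<And>i. i \<in> K \<Longrightarrow> (\<Sum>j\<in>N-{j0}. x j * B i j) = 0"
      using insert.IH[of "N-{j0}" B] insert.prems(1) by blast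
    define y where "y = x(j0 := - (\<Sum>j\<in>N-{j0}. x j * A k j) / A k j0)"
    have s: "(\<Sum>j\<in>N. y j * A i j) = y j0 * A i j0 + (\<Sum>j\<in>N-{j0}. x j * A i j)" for i
      using j0 insert by (subst sum.remove[of N j0]) (auto simp: y_def intro!: sum.cong)
    have "(\<Sum>j\<in>N. y j * A k j) = 0" unfolding s using j0 by (simp add: y_def)
    moreover have "(\<Sum>j\<in>N. y j * A i j) = 0" if "i \<in> K" for i
    proof -
      have "(\<Sum>j\<in>N-{j0}. x j * B i j) = (\<Sum>j\<in>N-{j0}. x j * A i j) - (\<Sum>j\<in>N-{j0}. x j * A k j) * (A i j0 / A k j0)"
        by (simp add: B_def sum_subtractf sum_distrib_right sum_divide_distrib right_diff_distrib mult.assoc)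
          (simp add: mult.commute mult.left_commute)
      with x(2)[OF that] show ?thesis unfolding s by (simp add: y_def)
    qed
    moreover have "\<exists>j\<in>N. y j \<noteq> 0" using x(1) by (auto simp: y_def)
    ultimately show ?thesis by auto
  qed
qed

text \<open>Bolzano-Weierstrass in finitely many coordinates, passing to a further subsequence for
  each one.\<close>

lemma convergent_subsequence_finite:
  fixes f :: "nat \<Rightarrow> 'a \<Rightarrow> complex"
  assumes "finite S" and "\<And>n x. x \<in> S \<Longrightarrow> cmod (f n x) \<le> 1"
  shows "\<exists>s l. strict_mono s \<and> (\<forall>x\<in>S. (\<lambda>n. f (s n) x) \<longlonglongrightarrow> l x)"
  using assms
proof (induction S rule: finite_induct)
  case empty
  then show ?case by (auto intro: exI[of _ id] simp: strict_mono_id)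
next
  case (insert a S)
  have "\<exists>s l. strict_mono s \<and> (\<forall>x\<in>S. (\<lambda>n. f (s n) x) \<longlonglongrightarrow> l x)"
    using insert.prems by (intro insert.IH) simp
  then obtain s l where s: "strict_mono s" "\<And>x. x \<in> S \<Longrightarrow> (\<lambda>n. f (s n) x) \<longlonglongrightarrow> l x" by blast
  have "bounded (range (\<lambda>n. f (s n) a))"
    using insert.prems by (auto simp: bounded_iff)
  then obtain l' t where t: "strict_mono t" "((\<lambda>n. f (s n) a) \<circ> t) \<longlonglongrightarrow> l'"
    using bounded_imp_convergent_subsequence by blast
  have "(\<lambda>n. f ((s \<circ> t) n) x) \<longlonglongrightarrow> (l(a := l')) x" if "x \<in> insert a S" for x
    using that t LIMSEQ_subseq_LIMSEQ[OF s(2) t(1)] insert.hyps by (auto simp: o_def)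
  with strict_mono_o[OF s(1) t(1)] show ?case by blast
qed

text \<open>The coefficients of the \<open>X j\<close> solve a linear system with more unknowns than
  equations. The bound \<open>r * D\<close> does not depend on \<open>R\<close>, which the limit
  argument requires.\<close>

lemma polynomial_kernel:
  fixes R :: "nat \<Rightarrow> 'j \<Rightarrow> 'a::field poly"
  assumes J: "finite J" "r < card J" and R: "\<And>k j. k < r \<Longrightarrow> j \<in> J \<Longrightarrow> degree (R k j) \<le> D"
  shows "\<exists>X. (\<exists>j\<in>J. X j \<noteq> 0) \<and> (\<forall>j\<in>J. degree (X j) \<le> r * D) \<and> (\<forall>k<r. (\<Sum>j\<in>J. X j * R k j) = 0)"
proof -
  let ?N = "r * D"
  let ?A = "\<lambda>(k,t) (j,s). coeff (monom 1 s * R k j) t"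
  \<comment> \<open>With \<open>?N = r * D\<close> the right side exceeds the left by exactly
    one.\<close>
  have "r * (?N + D + 1) < (r + 1) * (?N + 1)" by (simp add: algebra_simps)
  also have "\<dots> \<le> card J * (?N + 1)" using J(2) by (intro mult_right_mono) auto
  finally have "card ({..<r} \<times> {..?N + D}) < card (J \<times> {..?N})"
    using J(1) by (simp add: card_cartesian_product)
  then obtain x where x: "\<exists>p\<in>J \<times> {..?N}. x p \<noteq> 0"
    "\<And>k t. k < r \<Longrightarrow> t \<le> ?N + D \<Longrightarrow> (\<Sum>p\<in>J \<times> {..?N}. x p * ?A (k,t) p) = 0"
    using underdetermined_system[of "{..<r} \<times> {..?N + D}" "J \<times> {..?N}" ?A] J(1) by auto
  define X where "X j = (\<Sum>s\<le>?N. monom (x (j,s)) s)" for j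
  have deg: "degree (X j) \<le> ?N" for j
    unfolding X_def by (intro degree_sum_le) (auto intro: order.trans[OF degree_monom_le])
  have cX: "coeff (X j) s = x (j,s)" if "s \<le> ?N" for j s
    using that by (simp add: X_def coeff_sum)
  have "coeff (\<Sum>j\<in>J. X j * R k j) t = 0" if "k < r" for k t
  proof (cases "t \<le> ?N + D")
    case True
    have "coeff (\<Sum>j\<in>J. X j * R k j) t = (\<Sum>j\<in>J. \<Sum>s\<le>?N. x (j,s) * coeff (monom 1 s * R k j) t)"
      by (simp add: X_def coeff_sum sum_distrib_right coeff_monom_mult if_distrib cong: if_cong)
    also have "\<dots> = (\<Sum>p\<in>J \<times> {..?N}. x p * ?A (k,t) p)"
      by (simp add: sum.cartesian_product case_prod_unfold)
    finally show ?thesis using x(2)[OF that True] by simp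
  next
    case False
    have "degree (X j * R k j) \<le> ?N + D" if "j \<in> J" for j
      using degree_mult_le[of "X j" "R k j"] deg[of j] R[OF \<open>k < r\<close> that] by linarith
    then have "degree (\<Sum>j\<in>J. X j * R k j) \<le> ?N + D" using J(1) by (intro degree_sum_le)
    with False show ?thesis by (intro coeff_eq_0) simp
  qed
  then have "(\<Sum>j\<in>J. X j * R k j) = 0" if "k < r" for k
    using that by (intro poly_eqI) simp
  moreover have "\<exists>j\<in>J. X j \<noteq> 0"
  proof -
    from x(1) obtain j s where js: "j \<in> J" "s \<le> ?N" "x (j,s) \<noteq> 0" by auto
    with cX[of s j] have "X j \<noteq> 0" by auto
    with js(1) show ?thesis ..
  qed
  ultimately show ?thesis using deg by blast
qed

text \<open>The normalization bounds every coefficient, giving compactness, and it passes to the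
  limit, so that a limit relation cannot be trivial.\<close>

lemma polynomial_kernel_normalized:
  fixes R :: "nat \<Rightarrow> 'j \<Rightarrow> complex poly"
  assumes J: "finite J" "r < card J" and R: "\<And>k j. k < r \<Longrightarrow> j \<in> J \<Longrightarrow> degree (R k j) \<le> D"
  shows "\<exists>X. (\<Sum>j\<in>J. \<Sum>s\<le>r * D. cmod (coeff (X j) s)) = 1 \<and> (\<forall>j\<in>J. degree (X j) \<le> r * D) \<and>
     (\<forall>k<r. (\<Sum>j\<in>J. X j * R k j) = 0)"
proof -
  obtain X where X: "\<exists>j\<in>J. X j \<noteq> 0" "\<And>j. j \<in> J \<Longrightarrow> degree (X j) \<le> r * D"
    "\<And>k. k < r \<Longrightarrow> (\<Sum>j\<in>J. X j * R k j) = 0"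
    using polynomial_kernel[of J r R D] assms by blast
  define N where "N = (\<Sum>j\<in>J. \<Sum>s\<le>r * D. cmod (coeff (X j) s))"
  have "N \<noteq> 0"
  proof
    assume "N = 0"
    then have "\<forall>j\<in>J. \<forall>s\<le>r*D. coeff (X j) s = 0"
      using J by (simp add: N_def sum_nonneg_eq_0_iff sum_nonneg)
    then have "\<forall>j\<in>J. lead_coeff (X j) = 0" using X(2) by blast
    with X(1) show False by auto
  qed
  moreover have "N \<ge> 0" unfolding N_def by (intro sum_nonneg) simp
  ultimately have N: "N > 0" by simp
  let ?Y = "\<lambda>j. smult (of_real (inverse N)) (X j)"
  have "(\<Sum>j\<in>J. \<Sum>s\<le>r * D. cmod (coeff (?Y j) s))
      = inverse N * (\<Sum>j\<in>J. \<Sum>s\<le>r * D. cmod (coeff (X j) s))"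
    using N by (simp add: norm_mult sum_distrib_left norm_inverse)
  with N have "(\<Sum>j\<in>J. \<Sum>s\<le>r * D. cmod (coeff (?Y j) s)) = 1"
    by (simp flip: N_def)
  moreover have "\<forall>j\<in>J. degree (?Y j) \<le> r * D" using X(2) order.trans[OF degree_smult_le] by blast
  moreover have "(\<Sum>j\<in>J. ?Y j * R k j) = 0" if "k < r" for k
    using X(3)[OF that] by (simp add: smult_sum_right[symmetric])
  ultimately show ?thesis by (intro exI[of _ ?Y]) blast
qed

lemma normal_rank_to_fract: "normal_rank m n P = mat_rank m n (\<lambda>i j. to_fract (P i j))"
  by (simp add: normal_rank_def to_fract_def)

lemma normal_rank_le_if_in_pclosure:
  assumes P: "P \<in> pclosure m n d (prod_set m n r d D)" and D: "\<And>k. k < r \<Longrightarrow> D k \<le> d"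
  shows "normal_rank m n P \<le> r"
proof -
  have "card J \<le> r" if J: "J \<subseteq> {..<n}" "lin_indep_cols m (\<lambda>i j. to_fract (P i j)) J" for J
  proof (rule ccontr)
    assume "\<not> card J \<le> r"
    then have card: "r < card J" by simp
    have fin: "finite J" using J(1) finite_subset by blast
    let ?N = "r * d"
    \<comment> \<open>A matrix near \<open>P\<close> and a normalized relation among its columns in
      \<open>J\<close> are chosen together. Membership in \<open>pmat_deg\<close> is recorded
      because \<open>pdist\<close> sees only coefficients up to \<open>d\<close>.\<close>
    define ok where "ok t Q X \<longleftrightarrow> Q \<in> pmat_deg m n d \<and> pdist m n d P Q < inverse (real (Suc t)) \<and>
       (\<Sum>j\<in>J. \<Sum>s\<le>?N. cmod (coeff (X j) s)) = 1 \<and> (\<forall>j\<in>J. degree (X j) \<le> ?N) \<and>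
       (\<forall>i<m. (\<Sum>j\<in>J. X j * Q i j) = 0)" for t Q X
    have "\<exists>QX. ok t (fst QX) (snd QX)" for t
    proof -
      have "inverse (real (Suc t)) > 0" by simp
      then obtain Q where Q: "Q \<in> prod_set m n r d D" "pdist m n d P Q < inverse (real (Suc t))"
        using P unfolding pclosure_def by blast
      then obtain L R where QL: "Q = pmult m r n L R"
        and R: "\<And>k j. k < r \<Longrightarrow> j < n \<Longrightarrow> degree (R k j) \<le> D k"
        by (auto simp: prod_set_def)
      have "degree (R k j) \<le> d" if "k < r" "j \<in> J" for k j
        using R[of k j] D[of k] that J(1) by force
      then obtain X where X: "(\<Sum>j\<in>J. \<Sum>s\<le>?N. cmod (coeff (X j) s)) = 1" "\<forall>j\<in>J. degree (X j) \<le> ?N"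
        "\<And>k. k < r \<Longrightarrow> (\<Sum>j\<in>J. X j * R k j) = 0"
        using polynomial_kernel_normalized[OF fin card, of R d] by blast
      have "(\<Sum>j\<in>J. X j * Q i j) = 0" if "i < m" for i
      proof -
        have "(\<Sum>j\<in>J. X j * Q i j) = (\<Sum>j\<in>J. \<Sum>k<r. L i k * (X j * R k j))"
          using J(1) that by (intro sum.cong refl) (auto simp: QL pmult_def sum_distrib_left algebra_simps)
        also have "\<dots> = (\<Sum>k<r. L i k * (\<Sum>j\<in>J. X j * R k j))"
          by (subst sum.swap) (simp add: sum_distrib_left)
        also have "\<dots> = 0" using X(3) by simp
        finally show ?thesis .
      qed
      moreover have "Q \<in> pmat_deg m n d" using Q(1) prod_set_subset_pmat_deg[of r D d m n] D by blast
      ultimately have "ok t Q X" using Q(2) X unfolding ok_def by blast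
      then show ?thesis by (intro exI[of _ "(Q, X)"]) simp
    qed
    then obtain QX where "\<And>t. ok t (fst (QX t)) (snd (QX t))" by metis
    then have ok: "ok t (fst (QX t)) (snd (QX t))" for t .
    define Q where "Q t = fst (QX t)" for t
    define X where "X t = snd (QX t)" for t
    have Q: "\<And>t. Q t \<in> pmat_deg m n d"
      and dist: "\<And>t. pdist m n d P (Q t) < inverse (real (Suc t))"
      and norm1: "\<And>t. (\<Sum>j\<in>J. \<Sum>s\<le>?N. cmod (coeff (X t j) s)) = 1"
      and degX: "\<And>t j. j \<in> J \<Longrightarrow> degree (X t j) \<le> ?N"
      and ker: "\<And>t i. i < m \<Longrightarrow> (\<Sum>j\<in>J. X t j * Q t i j) = 0"
      using ok unfolding ok_def Q_def X_def by blast+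
    have bd: "cmod (case x of (j,s) \<Rightarrow> coeff (X t j) s) \<le> 1" if "x \<in> J \<times> {..?N}" for x t
    proof -
      have "cmod (case x of (j,s) \<Rightarrow> coeff (X t j) s) \<le> (\<Sum>x\<in>J\<times>{..?N}. cmod (case x of (j,s) \<Rightarrow> coeff (X t j) s))"
        using fin that by (intro member_le_sum) auto
      also have "\<dots> = 1" using norm1[of t] by (simp add: sum.cartesian_product case_prod_unfold)
      finally show ?thesis .
    qed
    have "\<exists>s l. strict_mono s \<and> (\<forall>x\<in>J \<times> {..?N}. (\<lambda>t. case x of (j,s') \<Rightarrow> coeff (X (s t) j) s') \<longlonglongrightarrow> l x)"
      by (rule convergent_subsequence_finite) (use fin bd in simp_all)
    then obtain \<sigma> l where \<sigma>: "strict_mono \<sigma>"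
      and l: "\<And>x. x \<in> J \<times> {..?N} \<Longrightarrow> (\<lambda>t. case x of (j,s) \<Rightarrow> coeff (X (\<sigma> t) j) s) \<longlonglongrightarrow> l x"
      by blast
    define Y where "Y j = (\<Sum>s\<le>?N. monom (l (j,s)) s)" for j
    have cY: "coeff (Y j) s = (if s \<le> ?N then l (j,s) else 0)" for j s
      by (simp add: Y_def coeff_sum)
    have limX: "(\<lambda>t. coeff (X (\<sigma> t) j) s) \<longlonglongrightarrow> coeff (Y j) s" if "j \<in> J" for j s
    proof (cases "s \<le> ?N")
      case True
      with l[of "(j,s)"] that show ?thesis by (simp add: cY)
    next
      case False
      then have "coeff (X t j) s = 0" for t using degX[OF that, of t] by (intro coeff_eq_0) simp
      with False show ?thesis by (simp add: cY)
    qed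
    have limQ: "(\<lambda>t. coeff (Q (\<sigma> t) i j) s) \<longlonglongrightarrow> coeff (P i j) s" if "i < m" "j < n" for i j s
    proof (cases "s \<le> d")
      case True
      have "(\<lambda>t. coeff (P i j) s - coeff (Q t i j) s) \<longlonglongrightarrow> 0"
      proof (rule Lim_null_comparison[OF _ LIMSEQ_inverse_real_of_nat])
        show "eventually (\<lambda>t. cmod (coeff (P i j) s - coeff (Q t i j) s) \<le> inverse (real (Suc t))) sequentially"
          using coeff_diff_le_pdist[OF that True, of P] dist by (intro always_eventually) (meson less_imp_le order.trans)
      qed
      from tendsto_diff[OF tendsto_const this, of "coeff (P i j) s"]
      have "(\<lambda>t. coeff (Q t i j) s) \<longlonglongrightarrow> coeff (P i j) s" by simp
      from LIMSEQ_subseq_LIMSEQ[OF this \<sigma>] show ?thesis by (simp add: o_def)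
    next
      case False
      have "coeff A s = 0" if "degree A \<le> d" for A :: "complex poly"
        using that False by (intro coeff_eq_0) simp
      moreover have "degree (P i j) \<le> d" "degree (Q t i j) \<le> d" for t
        using P Q[of t] that by (simp_all add: pclosure_def pmat_deg_def)
      ultimately have "coeff (P i j) s = 0" "coeff (Q t i j) s = 0" for t by blast+
      then show ?thesis by simp
    qed
    have "coeff (\<Sum>j\<in>J. Y j * P i j) s = 0" if "i < m" for i s
    proof -
      \<comment> \<open>Each coefficient of a product is a finite convolution, so the relations pass
        to the limit coefficientwise.\<close>
      have "(\<lambda>t. \<Sum>j\<in>J. \<Sum>k\<le>s. coeff (X (\<sigma> t) j) k * coeff (Q (\<sigma> t) i j) (s - k)) \<longlonglongrightarrow>
         (\<Sum>j\<in>J. \<Sum>k\<le>s. coeff (Y j) k * coeff (P i j) (s - k))"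
        using J(1) that by (intro tendsto_sum tendsto_mult limX limQ) auto
      moreover have "(\<Sum>j\<in>J. \<Sum>k\<le>s. coeff (X t j) k * coeff (Q t i j) (s - k)) = 0" for t
        using arg_cong[OF ker[OF that, of t], of "\<lambda>p. coeff p s"] by (simp add: coeff_sum coeff_mult)
      ultimately have "(\<Sum>j\<in>J. \<Sum>k\<le>s. coeff (Y j) k * coeff (P i j) (s - k)) = 0"
        by (simp add: LIMSEQ_const_iff)
      then show ?thesis by (simp add: coeff_sum coeff_mult)
    qed
    then have "(\<Sum>j\<in>J. Y j * P i j) = 0" if "i < m" for i
      using that by (intro poly_eqI) simp
    then have "to_fract (\<Sum>j\<in>J. Y j * P i j) = to_fract 0" if "i < m" for i
      using that by simp
    then have "\<forall>i<m. (\<Sum>j\<in>J. to_fract (Y j) * to_fract (P i j)) = 0"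
      by simp
    then have "\<forall>j\<in>J. to_fract (Y j) = 0"
      using J(2) unfolding lin_indep_cols_def by (elim allE[of _ "\<lambda>j. to_fract (Y j)"]) blast
    then have Y0: "Y j = 0" if "j \<in> J" for j using that by simp
    \<comment> \<open>The norms are constantly 1, while independence of the columns has forced the
      limit \<open>Y\<close> to vanish on \<open>J\<close>.\<close>
    have "(\<lambda>t. \<Sum>j\<in>J. \<Sum>s\<le>?N. cmod (coeff (X (\<sigma> t) j) s)) \<longlonglongrightarrow> (\<Sum>j\<in>J. \<Sum>s\<le>?N. cmod (coeff (Y j) s))"
      by (intro tendsto_sum tendsto_norm limX)
    then show False using Y0 by (simp add: norm1 LIMSEQ_const_iff)
  qed
  moreover have "finite {card J | J. J \<subseteq> {..<n} \<and> lin_indep_cols m (\<lambda>i j. to_fract (P i j)) J}"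
    by (rule finite_subset[of _ "card ` Pow {..<n}"]) auto
  moreover have "card {} \<in> {card J | J. J \<subseteq> {..<n} \<and> lin_indep_cols m (\<lambda>i j. to_fract (P i j)) J}"
    by (intro CollectI exI[of _ "{}"]) (simp add: lin_indep_cols_def)
  ultimately show ?thesis unfolding normal_rank_to_fract mat_rank_def
    by (subst Max_le_iff) blast+
qed

subsection \<open>Factorizations without degree cancellation\<close>

text \<open>\<open>D k\<close> only bounds the degree of row \<open>k\<close>, and \<open>L\<close>
  carries no bound. The index set \<open>I\<close> may shrink; the measure
  \<open>\<Sum>k\<in>I. D k + 1\<close> falls both when a bound is lowered and when an index is
  dropped.\<close>

definition weighted_fact ::
  "nat \<Rightarrow> nat \<Rightarrow> pmatrix \<Rightarrow> nat set \<Rightarrow> pmatrix \<Rightarrow> pmatrix \<Rightarrow> (nat \<Rightarrow> nat) \<Rightarrow> bool" where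
  "weighted_fact m n M I L R D \<longleftrightarrow> finite I \<and>
     (\<forall>i<m. \<forall>j<n. M i j = (\<Sum>k\<in>I. L i k * R k j)) \<and>
     (\<forall>k\<in>I. \<forall>j<n. degree (R k j) \<le> D k)"

text \<open>The common step for roots and infinity. As \<open>e k0\<close> is a nonzero constant,
  the relation can be solved for row \<open>k0\<close>; substituting it replaces that row by
  \<open>w\<close> and adjusts \<open>L\<close>. If \<open>D k0 = 0\<close>, then \<open>w\<close>
  vanishes and the index is removed.\<close>

lemma weighted_fact_exchange:
  assumes W: "weighted_fact m n M I L R D" and k0: "k0 \<in> I" "c \<noteq> 0" "e k0 = [:c:]"
    and w: "\<And>j. j < n \<Longrightarrow> (\<Sum>k\<in>I. e k * R k j) = s * w j"
    and w_deg: "\<And>j. j < n \<Longrightarrow> degree (w j) \<le> D k0 - 1"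
    and w_0: "\<And>j. j < n \<Longrightarrow> D k0 = 0 \<Longrightarrow> w j = 0"
  shows "\<exists>I' L' R' D'. I' \<subseteq> I \<and> weighted_fact m n M I' L' R' D' \<and>
     (\<Sum>k\<in>I'. D' k + 1) < (\<Sum>k\<in>I. D k + 1)"
proof -
  have fin: "finite I" and M: "\<And>i j. i < m \<Longrightarrow> j < n \<Longrightarrow> M i j = (\<Sum>k\<in>I. L i k * R k j)"
    and R: "\<And>k j. k \<in> I \<Longrightarrow> j < n \<Longrightarrow> degree (R k j) \<le> D k"
    using W by (auto simp: weighted_fact_def)
  define L' where "L' i k = (if k = k0 then smult (1/c) (L i k0 * s)
     else L i k - smult (1/c) (L i k0 * e k))" for i k
  define R' where "R' = R(k0 := w)"
  have sp: "(\<Sum>k\<in>I. h k) = h k0 + (\<Sum>k\<in>I-{k0}. h k)" for h :: "nat \<Rightarrow> complex poly"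
    using fin k0 by (simp add: sum.remove)
  have eq: "M i j = smult (1/c) (L i k0 * s) * w j + (\<Sum>k\<in>I-{k0}. L' i k * R' k j)"
    if ij: "i < m" "j < n" for i j
  proof -
    have "(\<Sum>k\<in>I-{k0}. L' i k * R' k j)
        = (\<Sum>k\<in>I-{k0}. L i k * R k j) - smult (1/c) (L i k0 * (\<Sum>k\<in>I-{k0}. e k * R k j))"
      by (simp add: L'_def R'_def left_diff_distrib sum_subtractf sum_distrib_left smult_sum_right mult.assoc)
    also have "(\<Sum>k\<in>I-{k0}. e k * R k j) = s * w j - [:c:] * R k0 j"
      using w[OF ij(2)] k0(3) unfolding sp[of "\<lambda>k. e k * R k j"] by (simp add: algebra_simps)
    also have "smult (1/c) (L i k0 * (s * w j - [:c:] * R k0 j))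
        = smult (1/c) (L i k0 * s) * w j - L i k0 * R k0 j"
      using k0(2) by (simp add: right_diff_distrib smult_diff_right mult.assoc)
    finally show ?thesis unfolding M[OF ij] sp[of "\<lambda>k. L i k * R k j"] by simp
  qed
  show ?thesis
  proof (cases "D k0 = 0")
    case True
    have "weighted_fact m n M (I - {k0}) L' R' D"
      unfolding weighted_fact_def using fin eq w_0[OF _ True] R by (auto simp: R'_def)
    moreover have "(\<Sum>k\<in>I-{k0}. D k + 1) < (\<Sum>k\<in>I. D k + 1)"
      using fin k0 by (simp add: sum.remove[of I k0])
    ultimately show ?thesis by blast
  next
    case False
    let ?D = "D(k0 := D k0 - 1)"
    have "weighted_fact m n M I L' R' ?D"
      unfolding weighted_fact_def using fin eq w_deg R
      by (auto simp: R'_def sp L'_def)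
    moreover have "(\<Sum>k\<in>I. ?D k + 1) < (\<Sum>k\<in>I. D k + 1)"
      using fin k0 False by (intro sum_strict_mono_ex1) (auto intro!: bexI[of _ k0])
    ultimately show ?thesis by blast
  qed
qed

lemma ex_max_nat:
  fixes D :: "'a \<Rightarrow> nat"
  assumes "finite A" "A \<noteq> {}"
  shows "\<exists>k\<in>A. \<forall>l\<in>A. D l \<le> D k"
proof -
  have "Max (D ` A) \<in> D ` A" using assms by (intro Max_in) auto
  then obtain k where "k \<in> A" "Max (D ` A) = D k" by auto
  with assms show ?thesis by (metis Max_ge finite_imageI image_eqI)
qed

text \<open>The combination vanishes at \<alpha>, so it is divisible by \<open>x - \<alpha>\<close>.
  Taking \<open>k0\<close> of largest bound among the rows involved makes the quotient smaller than
  \<open>D k0\<close> permits.\<close>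

lemma weighted_fact_reduce_at_root:
  assumes W: "weighted_fact m n M I L R D" and c: "\<exists>k\<in>I. c k \<noteq> 0"
    and dep: "\<And>j. j < n \<Longrightarrow> (\<Sum>k\<in>I. c k * poly (R k j) \<alpha>) = 0"
  shows "\<exists>I' L' R' D'. I' \<subseteq> I \<and> weighted_fact m n M I' L' R' D' \<and>
     (\<Sum>k\<in>I'. D' k + 1) < (\<Sum>k\<in>I. D k + 1)"
proof -
  have fin: "finite I" and R: "\<And>k j. k \<in> I \<Longrightarrow> j < n \<Longrightarrow> degree (R k j) \<le> D k"
    using W by (auto simp: weighted_fact_def)
  obtain k0 where k0: "k0 \<in> I" "c k0 \<noteq> 0" and max: "\<And>k. k \<in> I \<Longrightarrow> c k \<noteq> 0 \<Longrightarrow> D k \<le> D k0"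
    using ex_max_nat[of "{k\<in>I. c k \<noteq> 0}" D] fin c by auto
  define S where "S j = (\<Sum>k\<in>I. [:c k:] * R k j)" for j
  define w where "w j = S j div [:- \<alpha>, 1:]" for j
  have S: "S j = [:- \<alpha>, 1:] * w j" if "j < n" for j
  proof -
    have "poly (S j) \<alpha> = 0" using dep[OF that] by (simp add: S_def poly_sum)
    then have "[:- \<alpha>, 1:] dvd S j" by (simp add: poly_eq_0_iff_dvd)
    then show ?thesis unfolding w_def by (rule dvd_mult_div_cancel[symmetric])
  qed
  have "degree (S j) \<le> D k0" if "j < n" for j
    unfolding S_def
  proof (rule degree_sum_le[OF fin])
    show "degree ([:c k:] * R k j) \<le> D k0" if "k \<in> I" for k
      using max[OF that] R[OF that \<open>j < n\<close>] by (cases "c k = 0") auto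
  qed
  moreover have "degree (S j) = Suc (degree (w j))" if "j < n" "w j \<noteq> 0" for j
    unfolding S[OF that(1)] using that(2) by (subst degree_mult_eq) auto
  ultimately have *: "Suc (degree (w j)) \<le> D k0" if "j < n" "w j \<noteq> 0" for j
    using that by metis
  show ?thesis
  proof (rule weighted_fact_exchange[OF W k0, where e = "\<lambda>k. [:c k:]" and s = "[:- \<alpha>, 1:]" and w = w])
    show "degree (w j) \<le> D k0 - 1" if "j < n" for j
      using *[OF that] by (cases "w j = 0") auto
    show "w j = 0" if "j < n" "D k0 = 0" for j
      using *[OF that(1)] that(2) by auto
  qed (use S in \<open>simp_all add: S_def\<close>)
qed

text \<open>The powers of \<open>x\<close> in \<open>e\<close> lift all rows involved to the largest
  bound \<open>D k0\<close>, where the dependence cancels the top coefficients.\<close>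

lemma weighted_fact_reduce_at_infinity:
  assumes W: "weighted_fact m n M I L R D" and c: "\<exists>k\<in>I. c k \<noteq> 0"
    and dep: "\<And>j. j < n \<Longrightarrow> (\<Sum>k\<in>I. c k * coeff (R k j) (D k)) = 0"
  shows "\<exists>I' L' R' D'. I' \<subseteq> I \<and> weighted_fact m n M I' L' R' D' \<and>
     (\<Sum>k\<in>I'. D' k + 1) < (\<Sum>k\<in>I. D k + 1)"
proof -
  have fin: "finite I" and R: "\<And>k j. k \<in> I \<Longrightarrow> j < n \<Longrightarrow> degree (R k j) \<le> D k"
    using W by (auto simp: weighted_fact_def)
  obtain k0 where k0: "k0 \<in> I" "c k0 \<noteq> 0" and max: "\<And>k. k \<in> I \<Longrightarrow> c k \<noteq> 0 \<Longrightarrow> D k \<le> D k0"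
    using ex_max_nat[of "{k\<in>I. c k \<noteq> 0}" D] fin c by auto
  define e where "e k = monom (c k) (D k0 - D k)" for k
  define w where "w j = (\<Sum>k\<in>I. e k * R k j)" for j
  have deg: "degree (w j) \<le> D k0" if "j < n" for j
    unfolding w_def
  proof (rule degree_sum_le[OF fin])
    fix k assume k: "k \<in> I"
    show "degree (e k * R k j) \<le> D k0"
    proof (cases "c k = 0")
      case False
      with degree_mult_le[of "e k" "R k j"] R[OF k that] max[OF k] degree_monom_le[of "c k" "D k0 - D k"]
      show ?thesis unfolding e_def by linarith
    qed (simp add: e_def)
  qed
  have top: "coeff (w j) (D k0) = 0" if "j < n" for j
  proof -
    have "coeff (e k * R k j) (D k0) = c k * coeff (R k j) (D k)" if "k \<in> I" for k
      using max[OF that] by (cases "c k = 0") (auto simp: e_def coeff_monom_mult)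
    then show ?thesis using dep[OF that] by (simp add: w_def coeff_sum)
  qed
  show ?thesis
  proof (rule weighted_fact_exchange[OF W k0, where e = e and s = 1 and w = w])
    show "degree (w j) \<le> D k0 - 1" if "j < n" for j
    proof (rule degree_le, intro allI impI)
      fix i assume "D k0 - 1 < i"
      then have "i = D k0 \<or> D k0 < i" by linarith
      then show "coeff (w j) i = 0" using deg[OF that] top[OF that] by (auto intro: coeff_eq_0)
    qed
    show "w j = 0" if "j < n" "D k0 = 0" for j
      using deg[OF that(1)] top[OF that(1)] that(2) leading_coeff_0_iff[of "w j"] by simp
  qed (auto simp: e_def w_def monom_0)
qed

text \<open>Induction on \<open>degree q\<close> plus the measure: cancelling a linear factor lowers
  the first summand, exchanging a row the second.\<close>

lemma weighted_fact_lead_independent: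
  assumes "weighted_fact m n (\<lambda>i j. q * P i j) I L R D" and "q \<noteq> 0"
  shows "\<exists>I' L' R' D'. I' \<subseteq> I \<and> weighted_fact m n P I' L' R' D' \<and>
     (\<forall>c. (\<forall>j<n. (\<Sum>k\<in>I'. c k * coeff (R' k j) (D' k)) = 0) \<longrightarrow> (\<forall>k\<in>I'. c k = 0))"
  using assms
proof (induction "degree q + (\<Sum>k\<in>I. D k + 1)" arbitrary: q I L R D rule: less_induct)
  case less
  have fin: "finite I" and M: "\<And>i j. i < m \<Longrightarrow> j < n \<Longrightarrow> q * P i j = (\<Sum>k\<in>I. L i k * R k j)"
    and R: "\<And>k j. k \<in> I \<Longrightarrow> j < n \<Longrightarrow> degree (R k j) \<le> D k"
    using less.prems(1) by (auto simp: weighted_fact_def)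
  have step: ?case if "\<exists>I' L' R' D'. I' \<subseteq> I \<and> weighted_fact m n (\<lambda>i j. q * P i j) I' L' R' D' \<and>
     (\<Sum>k\<in>I'. D' k + 1) < (\<Sum>k\<in>I. D k + 1)"
  proof -
    from that obtain I' L' R' D' where I': "I' \<subseteq> I" "weighted_fact m n (\<lambda>i j. q * P i j) I' L' R' D'"
      "(\<Sum>k\<in>I'. D' k + 1) < (\<Sum>k\<in>I. D k + 1)" by blast
    have "degree q + (\<Sum>k\<in>I'. D' k + 1) < degree q + (\<Sum>k\<in>I. D k + 1)" using I'(3) by simp
    from less.hyps[OF this I'(2) less.prems(2)] obtain J L2 R2 D2 where "J \<subseteq> I'"
      "weighted_fact m n P J L2 R2 D2 \<and>
        (\<forall>c. (\<forall>j<n. (\<Sum>k\<in>J. c k * coeff (R2 k j) (D2 k)) = 0) \<longrightarrow> (\<forall>k\<in>J. c k = 0))"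
      by blast
    with I'(1) show ?thesis
      by (intro exI[of _ J] exI[of _ L2] exI[of _ R2] exI[of _ D2]) auto
  qed
  show ?case
  proof (cases "degree q = 0")
    case True
    then obtain a where a: "q = [:a:]" by (meson degree_eq_zeroE)
    with less.prems(2) have "a \<noteq> 0" by simp
    show ?thesis
    proof (cases "\<forall>c. (\<forall>j<n. (\<Sum>k\<in>I. c k * coeff (R k j) (D k)) = 0) \<longrightarrow> (\<forall>k\<in>I. c k = 0)")
      case True
      have "P i j = (\<Sum>k\<in>I. smult (1/a) (L i k) * R k j)" if "i < m" "j < n" for i j
      proof -
        have "smult (1/a) (q * P i j) = (\<Sum>k\<in>I. smult (1/a) (L i k) * R k j)"
          unfolding M[OF that] by (simp add: smult_sum_right)
        with a \<open>a \<noteq> 0\<close> show ?thesis by simp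
      qed
      then have "weighted_fact m n P I (\<lambda>i k. smult (1/a) (L i k)) R D"
        using fin R by (auto simp: weighted_fact_def)
      with True show ?thesis by blast
    next
      case False
      then obtain c where "\<exists>k\<in>I. c k \<noteq> 0" "\<And>j. j < n \<Longrightarrow> (\<Sum>k\<in>I. c k * coeff (R k j) (D k)) = 0"
        by blast
      from weighted_fact_reduce_at_infinity[OF less.prems(1) this] show ?thesis by (rule step)
    qed
  next
    case False
    then have "\<not> constant (poly q)" by (simp add: constant_degree)
    then obtain \<alpha> where "poly q \<alpha> = 0" using fundamental_theorem_of_algebra by blast
    then obtain q' where q': "q = [:- \<alpha>, 1:] * q'" by (auto simp: poly_eq_0_iff_dvd)
    show ?thesis
    proof (cases "\<forall>c. (\<forall>j<n. (\<Sum>k\<in>I. c k * poly (R k j) \<alpha>) = 0) \<longrightarrow> (\<forall>k\<in>I. c k = 0)")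
      case True
      \<comment> \<open>At \<alpha> the product vanishes, so the values of row \<open>i\<close> of
        \<open>L\<close> are the coefficients of a relation among independent rows.\<close>
      have "[:- \<alpha>, 1:] dvd L i k" if "i < m" "k \<in> I" for i k
      proof -
        have "(\<Sum>k\<in>I. poly (L i k) \<alpha> * poly (R k j) \<alpha>) = 0" if "j < n" for j
        proof -
          have "(\<Sum>k\<in>I. poly (L i k) \<alpha> * poly (R k j) \<alpha>) = poly (q * P i j) \<alpha>"
            unfolding M[OF \<open>i < m\<close> that] by (simp add: poly_sum)
          also have "\<dots> = 0" by (simp add: q')
          finally show ?thesis .
        qed
        then have "poly (L i k) \<alpha> = 0"
          using True that(2) by (elim allE[of _ "\<lambda>k. poly (L i k) \<alpha>"]) blast
        then show ?thesis by (simp add: poly_eq_0_iff_dvd)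
      qed
      then have L: "L i k = [:- \<alpha>, 1:] * (L i k div [:- \<alpha>, 1:])" if "i < m" "k \<in> I" for i k
        using that by (metis dvd_mult_div_cancel)
      have "q' * P i j = (\<Sum>k\<in>I. (L i k div [:- \<alpha>, 1:]) * R k j)" if "i < m" "j < n" for i j
      proof -
        have "[:- \<alpha>, 1:] * (q' * P i j) = (\<Sum>k\<in>I. L i k * R k j)"
          using M[OF that] by (simp only: q' mult.assoc)
        also have "\<dots> = (\<Sum>k\<in>I. [:- \<alpha>, 1:] * ((L i k div [:- \<alpha>, 1:]) * R k j))"
          using L[OF that(1)] by (intro sum.cong refl) (metis mult.assoc)
        also have "\<dots> = [:- \<alpha>, 1:] * (\<Sum>k\<in>I. (L i k div [:- \<alpha>, 1:]) * R k j)"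
          by (simp only: sum_distrib_left)
        finally show ?thesis by (subst (asm) mult_cancel_left) simp
      qed
      then have W: "weighted_fact m n (\<lambda>i j. q' * P i j) I (\<lambda>i k. L i k div [:- \<alpha>, 1:]) R D"
        using fin R by (auto simp: weighted_fact_def)
      have "q' \<noteq> 0" using less.prems(2) q' by auto
      moreover from this have "degree q = Suc (degree q')"
        unfolding q' by (subst degree_mult_eq) auto
      ultimately show ?thesis using less.hyps[OF _ W] by simp
    next
      case False
      then obtain c where "\<exists>k\<in>I. c k \<noteq> 0" "\<And>j. j < n \<Longrightarrow> (\<Sum>k\<in>I. c k * poly (R k j) \<alpha>) = 0"
        by blast
      from weighted_fact_reduce_at_root[OF less.prems(1) this] show ?thesis by (rule step)
    qed
  qed
qed

lemma coeff_mult_degree_bound: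
  fixes p q :: "'a::idom poly"
  assumes "degree p \<le> a" "degree q \<le> b"
  shows "coeff (p * q) (a + b) = coeff p a * coeff q b"
proof (cases "degree p = a \<and> degree q = b")
  case True
  then show ?thesis using coeff_mult_degree_sum[of p q] by simp
next
  case False
  with assms have "degree p + degree q < a + b" "degree p < a \<or> degree q < b" by linarith+
  then show ?thesis using degree_mult_le[of p q] by (auto simp: coeff_eq_0)
qed

text \<open>The predictable degree property. At the maximal value \<open>?e\<close> of
  \<open>degree (L i k) + D k\<close>, the coefficients of row \<open>i\<close> of \<open>P\<close>
  form a nontrivial combination of independent vectors, so \<open>?e\<close> cannot exceed
  \<open>d\<close>.\<close>

lemma weighted_fact_degree_le:
  assumes W: "weighted_fact m n P I L R D"
    and indep: "\<And>c. (\<And>j. j < n \<Longrightarrow> (\<Sum>k\<in>I. c k * coeff (R k j) (D k)) = 0) \<Longrightarrow> (\<forall>k\<in>I. c k = 0)"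
    and i: "i < m" and P: "\<And>j. j < n \<Longrightarrow> degree (P i j) \<le> d"
    and k: "k \<in> I" "L i k \<noteq> 0"
  shows "degree (L i k) + D k \<le> d"
proof -
  have fin: "finite I" and M: "\<And>j. j < n \<Longrightarrow> P i j = (\<Sum>k\<in>I. L i k * R k j)"
    and R: "\<And>k j. k \<in> I \<Longrightarrow> j < n \<Longrightarrow> degree (R k j) \<le> D k"
    using W i by (auto simp: weighted_fact_def)
  obtain k0 where k0: "k0 \<in> I" "L i k0 \<noteq> 0"
    and max: "\<And>k. k \<in> I \<Longrightarrow> L i k \<noteq> 0 \<Longrightarrow> degree (L i k) + D k \<le> degree (L i k0) + D k0"
    using ex_max_nat[of "{k\<in>I. L i k \<noteq> 0}" "\<lambda>k. degree (L i k) + D k"] fin k by auto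
  let ?e = "degree (L i k0) + D k0"
  have "?e \<le> d"
  proof (rule ccontr)
    assume "\<not> ?e \<le> d"
    define c where "c k = (if L i k = 0 then 0 else coeff (L i k) (?e - D k))" for k
    have "(\<Sum>k\<in>I. c k * coeff (R k j) (D k)) = 0" if "j < n" for j
    proof -
      have "coeff (L i k * R k j) ?e = c k * coeff (R k j) (D k)" if "k \<in> I" for k
      proof (cases "L i k = 0")
        case False
        with max[OF that] have le: "degree (L i k) \<le> ?e - D k" and e: "?e - D k + D k = ?e" by linarith+
        from coeff_mult_degree_bound[OF le R[OF that \<open>j < n\<close>]] False show ?thesis
          unfolding e c_def by simp
      qed (simp add: c_def)
      then have "(\<Sum>k\<in>I. c k * coeff (R k j) (D k)) = coeff (P i j) ?e"
        by (simp add: M[OF that] coeff_sum)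
      also have "\<dots> = 0" using P[OF that] \<open>\<not> ?e \<le> d\<close> by (intro coeff_eq_0) linarith
      finally show ?thesis .
    qed
    then have "c k0 = 0" using indep[of c] k0(1) by blast
    with k0(2) show False by (simp add: c_def)
  qed
  with max[OF k] show ?thesis by linarith
qed

lemma common_denominator:
  fixes Y :: "'a::idom fract set"
  assumes "finite Y"
  shows "\<exists>q\<noteq>0. \<forall>y\<in>Y. \<exists>p. to_fract q * y = to_fract p"
  using assms
proof (induction rule: finite_induct)
  case empty
  show ?case by (auto intro: exI[of _ 1])
next
  case (insert y Y)
  then obtain q where q: "q \<noteq> 0" "\<And>z. z \<in> Y \<Longrightarrow> \<exists>p. to_fract q * z = to_fract p" by blast
  obtain a b where ab: "y = Fract a b" "b \<noteq> 0" by (cases y)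
  have "\<exists>p. to_fract (q * b) * z = to_fract p" if "z \<in> insert y Y" for z
  proof (cases "z = y")
    case True
    then have "to_fract (q * b) * z = to_fract (q * a)"
      using ab by (simp add: Fract_conv_to_fract)
    then show ?thesis by blast
  next
    case False
    with that q(2) obtain p where "to_fract q * z = to_fract p" by blast
    then have "to_fract (q * b) * z = to_fract (p * b)" by (simp add: mult_ac)
    then show ?thesis by blast
  qed
  with q(1) ab(2) show ?case by (intro exI[of _ "q * b"]) auto
qed

text \<open>A maximal independent set \<open>J\<close> of columns spans all columns over the
  fraction field; clearing denominators expresses \<open>q P\<close> through the columns of
  \<open>P\<close> in \<open>J\<close>.\<close>

lemma weighted_fact_if_normal_rank:
  "\<exists>J q L R D. q \<noteq> 0 \<and> card J = normal_rank m n P \<and> weighted_fact m n (\<lambda>i j. q * P i j) J L R D"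
proof -
  let ?A = "\<lambda>i j. to_fract (P i j)"
  let ?C = "{card J | J. J \<subseteq> {..<n} \<and> lin_indep_cols m ?A J}"
  have finC: "finite ?C" by (rule finite_subset[of _ "card ` Pow {..<n}"]) auto
  moreover have "card {} \<in> ?C"
    by (intro CollectI exI[of _ "{}"]) (simp add: lin_indep_cols_def)
  ultimately have "Max ?C \<in> ?C" by (intro Max_in) auto
  then obtain J where J: "J \<subseteq> {..<n}" "lin_indep_cols m ?A J" "card J = Max ?C" by auto
  have fin: "finite J" using J(1) finite_subset by blast
  have "\<exists>x. \<forall>i<m. ?A i j = (\<Sum>k\<in>J. x k * ?A i k)" if j: "j < n" for j
  proof (cases "j \<in> J")
    case True
    have "?A i j = (\<Sum>k\<in>J. (if k = j then 1 else 0) * ?A i k)" for i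
      using True fin by (simp add: if_distrib[of "\<lambda>x. x * _"] cong: if_cong)
    then show ?thesis by (intro exI[of _ "\<lambda>k. if k = j then 1 else 0"]) blast
  next
    case False
    have "\<not> lin_indep_cols m ?A (insert j J)"
    proof
      assume "lin_indep_cols m ?A (insert j J)"
      moreover have "insert j J \<subseteq> {..<n}" using J(1) j by auto
      ultimately have "card (insert j J) \<in> ?C" by blast
      then have "card (insert j J) \<le> card J" unfolding J(3) by (rule Max_ge[OF finC])
      with False fin show False by simp
    qed
    then obtain \<alpha> k where \<alpha>: "\<And>i. i < m \<Longrightarrow> (\<Sum>k\<in>insert j J. \<alpha> k * ?A i k) = 0"
      and k: "k \<in> insert j J" "\<alpha> k \<noteq> 0"
      unfolding lin_indep_cols_def by blast
    have eq: "\<alpha> j * ?A i j + (\<Sum>k\<in>J. \<alpha> k * ?A i k) = 0" if "i < m" for i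
      using \<alpha>[OF that] False fin by simp
    have "\<alpha> j \<noteq> 0"
    proof
      assume 0: "\<alpha> j = 0"
      with eq have "\<forall>i<m. (\<Sum>k\<in>J. \<alpha> k * ?A i k) = 0" by simp
      then have "\<forall>k\<in>J. \<alpha> k = 0" using J(2) unfolding lin_indep_cols_def by blast
      with k 0 show False by auto
    qed
    have "?A i j = (\<Sum>k\<in>J. (- \<alpha> k / \<alpha> j) * ?A i k)" if "i < m" for i
    proof -
      have "(\<Sum>k\<in>J. (- \<alpha> k / \<alpha> j) * ?A i k) = - (\<Sum>k\<in>J. \<alpha> k * ?A i k) / \<alpha> j"
        by (simp add: sum_divide_distrib sum_negf)
      also have "\<dots> = ?A i j"
        using eq[OF that] \<open>\<alpha> j \<noteq> 0\<close> by (simp add: field_simps add_eq_0_iff)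
      finally show ?thesis ..
    qed
    then show ?thesis by (intro exI[of _ "\<lambda>k. - \<alpha> k / \<alpha> j"]) blast
  qed
  then obtain x where x: "\<And>j i. j < n \<Longrightarrow> i < m \<Longrightarrow> ?A i j = (\<Sum>k\<in>J. x j k * ?A i k)"
    by metis
  have "finite ((\<lambda>(j,k). x j k) ` ({..<n} \<times> J))" using fin by simp
  from common_denominator[OF this] obtain q where q: "q \<noteq> 0"
    "\<And>j k. j < n \<Longrightarrow> k \<in> J \<Longrightarrow> \<exists>p. to_fract q * x j k = to_fract p" by fastforce
  define X where "X k j = (SOME p. to_fract q * x j k = to_fract p)" for k j
  have X: "to_fract q * x j k = to_fract (X k j)" if "j < n" "k \<in> J" for j k
    unfolding X_def by (rule someI_ex) (rule q(2)[OF that])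
  have "q * P i j = (\<Sum>k\<in>J. P i k * X k j)" if "i < m" "j < n" for i j
  proof -
    have "to_fract (q * P i j) = (\<Sum>k\<in>J. to_fract q * x j k * ?A i k)"
      using x[OF that(2,1)] by (simp add: sum_distrib_left mult.assoc)
    also have "\<dots> = to_fract (\<Sum>k\<in>J. P i k * X k j)"
      using X[OF that(2)] by (simp add: mult.commute)
    finally show ?thesis by (simp only: to_fract_eq_iff)
  qed
  \<comment> \<open>The sum of the degrees is merely a convenient bound for all entries of a
    row.\<close>
  then have "weighted_fact m n (\<lambda>i j. q * P i j) J P X (\<lambda>k. \<Sum>j<n. degree (X k j))"
    using fin by (auto simp: weighted_fact_def intro: member_le_sum)
  with q(1) J(3) show ?thesis unfolding normal_rank_to_fract mat_rank_def by blast
qed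

lemma pmat_dr_in_prod_set:
  assumes "P \<in> pmat_dr m n d r"
  shows "\<exists>D. (\<forall>k<r. D k \<le> d) \<and> P \<in> prod_set m n r d D"
proof -
  have P: "P \<in> pmat m n" "\<And>i j. i < m \<Longrightarrow> j < n \<Longrightarrow> degree (P i j) \<le> d" "normal_rank m n P \<le> r"
    using assms by (auto simp: pmat_dr_def pmat_deg_def)
  obtain J q L0 R0 D0 where J: "q \<noteq> 0" "card J = normal_rank m n P"
    "weighted_fact m n (\<lambda>i j. q * P i j) J L0 R0 D0"
    using weighted_fact_if_normal_rank by blast
  obtain I L R D where I: "I \<subseteq> J" and W: "weighted_fact m n P I L R D"
    and indep: "\<And>c. (\<And>j. j < n \<Longrightarrow> (\<Sum>k\<in>I. c k * coeff (R k j) (D k)) = 0) \<Longrightarrow> (\<forall>k\<in>I. c k = 0)"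
    using weighted_fact_lead_independent[OF J(3,1)] by blast
  have fin: "finite I" and M: "\<And>i j. i < m \<Longrightarrow> j < n \<Longrightarrow> P i j = (\<Sum>k\<in>I. L i k * R k j)"
    and R: "\<And>k j. k \<in> I \<Longrightarrow> j < n \<Longrightarrow> degree (R k j) \<le> D k"
    using W by (auto simp: weighted_fact_def)
  have "finite J" using J(3) by (simp add: weighted_fact_def)
  then have card: "card I \<le> r" using card_mono[OF _ I] J(2) P(3) by simp
  obtain h where h: "bij_betw h {..<card I} I"
    using ex_bij_betw_nat_finite[OF fin] by (auto simp: atLeast0LessThan)
  then have hI: "h k \<in> I" if "k < card I" for k using that by (auto simp: bij_betw_def)
  \<comment> \<open>The degree estimate needs a nonzero entry in the column of \<open>L\<close>.
    Summands with zero column, and the indices from \<open>card I\<close> up to \<open>r\<close>,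
    are set to zero with \<open>D' k = 0\<close>, as their bounds might exceed
    \<open>d\<close>.\<close>
  define good where "good k \<longleftrightarrow> k < card I \<and> (\<exists>i<m. L i (h k) \<noteq> 0)" for k
  define L' where "L' i k = (if good k then L i (h k) else 0)" for i k
  define R' where "R' k j = (if good k then R (h k) j else 0)" for k j
  define D' where "D' k = (if good k then D (h k) else 0)" for k
  have LD: "degree (L i (h k)) + D (h k) \<le> d" if "i < m" "k < card I" "L i (h k) \<noteq> 0" for i k
    using weighted_fact_degree_le[OF W indep that(1) P(2)[OF that(1)] hI[OF that(2)] that(3)] .
  have D': "D' k \<le> d" for k
    using LD[of _ k] by (auto simp: D'_def good_def) (metis add_leE)
  have "degree (R' k j) \<le> D' k" if "j < n" for k j
    using R[OF hI that] by (auto simp: R'_def D'_def good_def)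
  moreover have "degree (L' i k) \<le> d - D' k" if "i < m" for i k
    using LD[OF that, of k] by (cases "L i (h k) = 0") (auto simp: L'_def D'_def good_def)
  moreover have "P = pmult m r n L' R'"
  proof (intro ext)
    fix i j
    show "P i j = pmult m r n L' R' i j"
    proof (cases "i < m \<and> j < n")
      case True
      have "P i j = (\<Sum>k<card I. L i (h k) * R (h k) j)"
        using True M sum.reindex_bij_betw[OF h, of "\<lambda>k. L i k * R k j"] by simp
      also have "\<dots> = (\<Sum>k<card I. L' i k * R' k j)"
        using True by (intro sum.cong) (auto simp: L'_def R'_def good_def)
      also have "\<dots> = (\<Sum>k<r. L' i k * R' k j)"
        using card by (intro sum.mono_neutral_left) (auto simp: L'_def good_def)
      finally show ?thesis using True by (simp add: pmult_def)
    next
      case False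
      with P(1) show ?thesis by (auto simp: pmat_def pmult_def not_less)
    qed
  qed
  ultimately have "P \<in> prod_set m n r d D'" unfolding prod_set_def by blast
  with D' show ?thesis by blast
qed

subsection \<open>The decomposition theorem\<close>

theorem theorem4p13:
  fixes m n r d :: nat
  assumes "m \<ge> 2" and "n \<ge> 2" and "d \<ge> 1" and "0 < r" and "r < min m n"
  shows "(\<forall>a\<le>r*d. B_set m n r d a \<subseteq> C_set m n r d a)
       \<and> (\<forall>a\<le>r*d. pclosure m n d (B_set m n r d a) = pclosure m n d (C_set m n r d a))
       \<and> pmat_dr m n d r = (\<Union>a\<in>{0..r*d}. pclosure m n d (C_set m n r d a))
       \<and> (\<forall>P\<in>pmat_dr m n d r. \<exists>a::int. 0 \<le> a \<and> a \<le> int (r*d) \<and>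
              P \<in> pclosure m n d (C_set m n r d (nat a)))"
proof -
  have C: "C_set m n r d a = prod_set m n r d (bal_deg r a)" if "a \<le> r*d" for a
    using C_set_eq_prod_set that assms(4) .
  have BC: "B_set m n r d a \<subseteq> C_set m n r d a" if "a \<le> r*d" for a
    unfolding C[OF that] using B_set_subset_prod_set that assms(4) .
  have "C_set m n r d a \<subseteq> pclosure m n d (B_set m n r d a)" if "a \<le> r*d" for a
    unfolding C[OF that] using that assms by (intro prod_set_subset_pclosure_B_set) auto
  then have cl: "pclosure m n d (B_set m n r d a) = pclosure m n d (C_set m n r d a)" if "a \<le> r*d" for a
    using that pclosure_mono[OF BC[OF that], of m n d] pclosure_minimal by blast
  have cover: "\<exists>a\<le>r*d. P \<in> pclosure m n d (C_set m n r d a)" if P: "P \<in> pmat_dr m n d r" for P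
  proof -
    obtain D where D: "\<And>k. k < r \<Longrightarrow> D k \<le> d" "P \<in> prod_set m n r d D"
      using pmat_dr_in_prod_set[OF P] by blast
    \<comment> \<open>Moves between slots preserve the sum of the row bounds, so this sum determines
      the \<open>a\<close> that is reached.\<close>
    let ?a = "\<Sum>k<r. D k"
    have a: "?a \<le> r * d" using sum_bounded_above[of "{..<r}" D d] D(1) by simp
    have "prod_set m n r d D \<subseteq> pclosure m n d (prod_set m n r d (bal_deg r ?a))"
      using D(1) bal_deg_le[OF a assms(4)] sum_bal_deg[OF assms(4), of ?a]
      by (intro prod_set_balance) (auto simp: bal_deg_def)
    with D(2) have "P \<in> pclosure m n d (C_set m n r d ?a)" unfolding C[OF a] by (rule rev_subsetD)
    with a show ?thesis by blast
  qed
  \<comment> \<open>The converse inclusion of (iii): passing to the closure does not raise the rank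
    above \<open>r\<close>.\<close>
  have sub: "pclosure m n d (C_set m n r d a) \<subseteq> pmat_dr m n d r" if "a \<le> r*d" for a
  proof
    fix P assume P: "P \<in> pclosure m n d (C_set m n r d a)"
    then have "normal_rank m n P \<le> r"
      using normal_rank_le_if_in_pclosure bal_deg_le[OF that assms(4)] unfolding C[OF that] by blast
    moreover have "P \<in> pmat_deg m n d" using P by (simp add: pclosure_def)
    ultimately show "P \<in> pmat_dr m n d r" by (simp add: pmat_dr_def)
  qed
  have "\<exists>a::int. 0 \<le> a \<and> a \<le> int (r*d) \<and> P \<in> pclosure m n d (C_set m n r d (nat a))"
    if "P \<in> pmat_dr m n d r" for P
    using cover[OF that] by (metis nat_int of_nat_0_le_iff of_nat_le_iff)
  moreover have "pmat_dr m n d r = (\<Union>a\<in>{0..r*d}. pclosure m n d (C_set m n r d a))"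
    using cover sub by fastforce
  ultimately show ?thesis using BC cl by blast
qed

end
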